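(* Let $q\ge2$ and let $I=(L(u,v))\subset S=k[x_1,\ldots,x_n]$ be a completely squarefree lexsegment ideal generated in degree $q$, determined by the monomials $u=x_1x_F$ (with $F\subset\{2,\ldots,n\}$, $|F|=q-1$) and $v=x_{j_1}\cdots x_{j_q}$, $2\leq j_1<\ldots<j_q\leq n$. For $1\le t\le q$ put $A_t=[j_t]\setminus\{j_1,\ldots,j_{t-1}\}$. Then the minimal primary decomposition of $I$ is the following. If $x_2\nmid u$, then $$I=\bigcap_{|A_t|\leq n-q}P_{A_t}\ \cap\bigcap_{\substack{|A_t|=n-q+1\\ u/x_1\geq_{lex} v/x_{j_t}}}P_{A_t}\ \cap\bigcap_{\substack{G\subset[n],\ |G|=q-1,\ G\cap A_t\neq\emptyset\ \forall t\\ u/x_1\geq_{lex} x_G}}P_{G^c}\ \cap\bigcap_{\substack{P\in \mathrm{Min}((L^f(u)))\\ \mathrm{ht}\, P=n-q}} P,$$ and if $x_2\mid u$, then $$I=\bigcap_{|A_t|\leq n-q}P_{A_t}\ \cap\bigcap_{\substack{|A_t|=n-q+1\\ u/x_1\geq_{lex} v/x_{j_t}}}P_{A_t}\ \cap\bigcap_{\substack{G\subset[n]\setminus\{1\},\ |G|=q-1,\ G\cap A_t\neq\emptyset\ \forall t\\ u/x_1\geq_{lex} x_G}}P_{G^c}\ \cap\bigcap_{\substack{G\subset[n]\setminus\{1\},\ |G|=n-q+1\\ x_{G\setminus\{\min(G)\}}\geq_{lex}x_{F^c\setminus\{1\}}}}P_{G}\ \cap\bigcap_{\substack{P\in \mathrm{Min}((L^f(u)))\\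 \mathrm{ht}\, P=n-q}} P.$$ (In each of the first two intersections $t$ ranges over the indices $1\le t\le q$ satisfying the displayed condition.)
   Context: $k$ is a field, $S=k[x_1,\ldots,x_n]$, $[n]=\{1,\ldots,n\}$. Monomials are ordered lexicographically with $x_1>x_2>\cdots>x_n$. $\mathrm{Mon}_q^s(S)$ is the set of squarefree monomials of degree $q$ in $S$. For $u,v\in \mathrm{Mon}_q^s(S)$, $L(u,v)=\{w\in \mathrm{Mon}_q^s(S): u\geq_{lex}w\geq_{lex} v\}$ is the squarefree lexsegment set determined by $u,v$, and $L^f(u)=\{w\in \mathrm{Mon}_q^s(S): u\geq_{lex} w\}$. The (squarefree) shadow of a set $T$ of squarefree monomials is $\mathrm{Shad}(T)=\{wx_i: w\in T,\ x_i\nmid w,\ 1\leq i\leq n\}$, and iterated shadows are defined recursively. A squarefree lexsegment set (and the ideal it generates) is completely lexsegment if all of its iterated shadows are again squarefree lexsegment sets. For $A\subset[n]$: $x_A=\prod_{i\in A}x_i$, $P_A=(x_i: i\in A)$, $A^c=[n]\setminus A$, $\min(A)$ is the smallest element of $A$. $\mathrm{Min}(J)$ is the set of minimal primes of an ideal $J$ and $\mathrm{ht}$ denotes height. Minimal primary decomposition means the irredundant intersection of the minimal primes of the (squarefree, hence radical) ideal $I$. *)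

theory Defs
  imports "HOL-Algebra.Ideal" "HOL-Library.Poly_Mapping" "HOL-Library.Extended_Nat"
begin

text \<open>
  A monomial is represented by its exponent vector, so the product of monomials is \<open>+\<close> and
  the quotient by a divisor is \<open>-\<close>. The order \<open>\<le>\<close> that \<^theory>\<open>HOL-Library.Poly_Mapping\<close>
  puts on exponent vectors compares them at the smallest index where they differ. It is the
  lexicographic order with \<open>xvar 1 > xvar 2 > \<dots>\<close>.
\<close>

type_synonym mon = "nat \<Rightarrow>\<^sub>0 nat"
type_synonym 'k mpol = "mon \<Rightarrow>\<^sub>0 'k"

definition poly_ring :: "nat \<Rightarrow> 'k::field mpol ring" where
  "poly_ring n =
    \<lparr>carrier = {p. \<forall>m \<in> Poly_Mapping.keys p. Poly_Mapping.keys m \<subseteq> {1..n}},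
     monoid.mult = (*), one = 1, ring.zero = 0, add = (+)\<rparr>"

definition monomial :: "mon \<Rightarrow> 'k::field mpol" where
  "monomial m = Poly_Mapping.single m 1"

definition xvar :: "nat \<Rightarrow> mon" where
  "xvar i = Poly_Mapping.single i 1"

definition x_set :: "nat set \<Rightarrow> mon" where
  "x_set A = (\<Sum>i\<in>A. xvar i)"

definition mon_degree :: "mon \<Rightarrow> nat" where
  "mon_degree m = (\<Sum>i\<in>Poly_Mapping.keys m. Poly_Mapping.lookup m i)"

definition sqfree_mons :: "nat \<Rightarrow> nat \<Rightarrow> mon set" where
  "sqfree_mons n q =
    {m. Poly_Mapping.keys m \<subseteq> {1..n} \<and> (\<forall>i. Poly_Mapping.lookup m i \<le> 1) \<and> mon_degree m = q}"

definition lexseg :: "nat \<Rightarrow> nat \<Rightarrow> mon \<Rightarrow> mon \<Rightarrow> mon set" where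
  "lexseg n q u v = {w \<in> sqfree_mons n q. u \<ge> w \<and> w \<ge> v}"

definition final_lexseg :: "nat \<Rightarrow> nat \<Rightarrow> mon \<Rightarrow> mon set" where
  "final_lexseg n q u = {w \<in> sqfree_mons n q. u \<ge> w}"

definition shadow :: "nat \<Rightarrow> mon set \<Rightarrow> mon set" where
  "shadow n T = {w + xvar i | w i. w \<in> T \<and> i \<in> {1..n} \<and> i \<notin> Poly_Mapping.keys w}"

definition is_lexseg :: "nat \<Rightarrow> mon set \<Rightarrow> bool" where
  "is_lexseg n T \<longleftrightarrow>
    (\<exists>q u v. u \<in> sqfree_mons n q \<and> v \<in> sqfree_mons n q \<and> T = lexseg n q u v)"

text \<open>
  There are no squarefree monomials of degree greater than \<open>n\<close>, so sufficiently high iterated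
  shadows are empty. An empty shadow imposes no condition.
\<close>

definition completely_lexseg :: "nat \<Rightarrow> mon set \<Rightarrow> bool" where
  "completely_lexseg n T \<longleftrightarrow>
    is_lexseg n T \<and> (\<forall>i. (shadow n ^^ i) T = {} \<or> is_lexseg n ((shadow n ^^ i) T))"

definition mon_ideal :: "nat \<Rightarrow> mon set \<Rightarrow> 'k::field mpol set" where
  "mon_ideal n T = Idl\<^bsub>poly_ring n\<^esub> (monomial ` T)"

definition var_prime :: "nat \<Rightarrow> nat set \<Rightarrow> 'k::field mpol set" where
  "var_prime n A = mon_ideal n (xvar ` A)"

definition minimal_primes :: "('a, 'b) ring_scheme \<Rightarrow> 'a set \<Rightarrow> 'a set set" where
  "minimal_primes R J =
    {P. primeideal P R \<and> J \<subseteq> P \<and> (\<forall>Q. primeideal Q R \<and> J \<subseteq> Q \<and> Q \<subseteq> P \<longrightarrow> Q = P)}"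

definition height :: "('a, 'b) ring_scheme \<Rightarrow> 'a set \<Rightarrow> enat" where
  "height R P =
    Sup {enat l | l. \<exists>C. (\<forall>i\<le>l. primeideal (C i) R) \<and> (\<forall>i<l. C i \<subset> C (Suc i)) \<and> C l = P}"

text \<open>
  The minimal primary decomposition of a radical ideal: the irredundant intersection of its
  minimal primes. The intersection with the carrier gives the empty intersection the value \<open>R\<close>.
\<close>

definition minimal_primary_decomposition ::
    "('a, 'b) ring_scheme \<Rightarrow> 'a set \<Rightarrow> 'a set set \<Rightarrow> bool" where
  "minimal_primary_decomposition R I D \<longleftrightarrow>
    I = carrier R \<inter> \<Inter>D \<and>
    (\<forall>P\<in>D. I \<noteq> carrier R \<inter> \<Inter>(D - {P})) \<and>
    D = minimal_primes R I"

lemma cring_poly_ring: "cring (poly_ring n :: 'k::field mpol ring)"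
proof -
  let ?S = "{p :: 'k mpol. \<forall>m \<in> Poly_Mapping.keys p. Poly_Mapping.keys m \<subseteq> {1..n}}"
  have add: "p + q \<in> ?S" if "p \<in> ?S" "q \<in> ?S" for p q
    using that Poly_Mapping.keys_add[of p q] by blast
  have mult: "p * q \<in> ?S" if "p \<in> ?S" "q \<in> ?S" for p q
  proof -
    have "Poly_Mapping.keys m \<subseteq> {1..n}" if m: "m \<in> Poly_Mapping.keys (p * q)" for m
    proof -
      obtain a b where ab: "m = a + b" "a \<in> Poly_Mapping.keys p" "b \<in> Poly_Mapping.keys q"
        using keys_mult[of p q] m by blast
      then show ?thesis
        using \<open>p \<in> ?S\<close> \<open>q \<in> ?S\<close> Poly_Mapping.keys_add[of a b] by blast
    qed
    then show ?thesis by blast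
  qed
  have uminus: "- p \<in> ?S" if "p \<in> ?S" for p
    using that by simp
  have one: "1 \<in> ?S" and zero: "0 \<in> ?S"
    by simp_all
  have carr: "carrier (poly_ring n) = ?S"
    and ops: "a \<otimes>\<^bsub>poly_ring n\<^esub> b = a * b" "\<one>\<^bsub>poly_ring n\<^esub> = (1 :: 'k mpol)"
      "a \<oplus>\<^bsub>poly_ring n\<^esub> b = a + b" "\<zero>\<^bsub>poly_ring n\<^esub> = (0 :: 'k mpol)" for a b :: "'k mpol"
    by (simp_all add: poly_ring_def)
  show ?thesis
  proof (rule cringI)
    show "abelian_group (poly_ring n :: 'k mpol ring)"
    proof (rule abelian_groupI, unfold carr ops)
      show "\<exists>q\<in>?S. q + p = 0" if "p \<in> ?S" for p
        by (rule bexI[OF _ uminus[OF that]]) (rule left_minus)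
    qed (fact add zero | rule add.assoc add.commute add_0_left, assumption?)+
    show "Group.comm_monoid (poly_ring n :: 'k mpol ring)"
      by (rule comm_monoidI, unfold carr ops)
        (fact mult one | rule mult.assoc mult.commute mult_1_left)+
  qed (unfold ops, rule distrib_right)
qed

end

theory Submission
  imports Defs
begin

text \<open>
  The minimal primes of a squarefree monomial ideal are the primes \<open>P\<^sub>C\<close> for the minimal vertex
  covers \<open>C\<close> of the supports of its generators, so the theorem is about maximal sets \<open>B = [n] - C\<close>
  containing no member of \<open>L(u, v)\<close>. Complete lexsegments enter through the first shadow: if
  \<open>|B| > q\<close>, then \<open>B\<close> contains a member of \<open>L(u, v)\<close> as soon as it contains some \<open>q\<close>-set \<open>\<ge> v\<close>, and
  this fails exactly when \<open>B\<close> misses some \<open>A\<^sub>t\<close>. Hence the minimal covers with fewer than \<open>n - q\<close>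
  elements are the \<open>A\<^sub>t\<close>. For \<open>|B| = q\<close> one has \<open>B < v\<close>, which again gives the \<open>A\<^sub>t\<close>, or \<open>B > u\<close>, which
  gives the minimal primes of height \<open>n - q\<close> of \<open>(L\<^sup>f(u))\<close>. For \<open>|B| = q - 1\<close> the condition is that
  all \<open>B \<union> {b}\<close> lie in \<open>L(u, v)\<close>, which splits according to whether \<open>1 \<in> B\<close>.
  The height of \<open>P\<^sub>C\<close> is \<open>|C|\<close> because prime chains in \<open>k[x\<^sub>1, \<dots>, x\<^sub>n]\<close> have length at most \<open>n\<close>.
\<close>

section \<open>Ideals of the polynomial ring\<close>

lemma poly_ring_carrier_iff:
  "p \<in> carrier (poly_ring n) \<longleftrightarrow> (\<forall>m\<in>Poly_Mapping.keys p. Poly_Mapping.keys m \<subseteq> {1..n})"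
  by (simp add: poly_ring_def)

lemma poly_ring_ops [simp]:
  "a \<otimes>\<^bsub>poly_ring n\<^esub> b = a * b" "\<one>\<^bsub>poly_ring n\<^esub> = 1"
  "a \<oplus>\<^bsub>poly_ring n\<^esub> b = a + b" "\<zero>\<^bsub>poly_ring n\<^esub> = 0"
  by (simp_all add: poly_ring_def)

lemma ring_poly_ring: "ring (poly_ring n)"
  using cring_poly_ring cring.axioms(1) by blast

lemma poly_ring_a_inv:
  assumes "p \<in> carrier (poly_ring n)"
  shows "\<ominus>\<^bsub>poly_ring n\<^esub> p = - p"
proof -
  interpret cring "poly_ring n :: 'a mpol ring" by (rule cring_poly_ring)
  have "- p \<in> carrier (poly_ring n)"
    using assms by (simp add: poly_ring_carrier_iff)
  then show ?thesis
    using minus_equality[of "- p" p] assms by simp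
qed

text \<open>Additive inverses come from absorption with the factor \<open>- 1\<close>, which lies in
  the carrier.\<close>

lemma poly_ring_idealI:
  fixes J :: "'k::field mpol set"
  assumes "J \<subseteq> carrier (poly_ring n)" "0 \<in> J"
    and "\<And>a b. a \<in> J \<Longrightarrow> b \<in> J \<Longrightarrow> a + b \<in> J"
    and "\<And>a x. a \<in> J \<Longrightarrow> x \<in> carrier (poly_ring n) \<Longrightarrow> x * a \<in> J"
  shows "ideal J (poly_ring n)"
proof (rule idealI[OF ring_poly_ring])
  interpret cring "poly_ring n :: 'k mpol ring" by (rule cring_poly_ring)
  have "- a \<in> J" if "a \<in> J" for a
    using assms(4)[OF that, of "- 1"] by (simp add: poly_ring_carrier_iff)
  moreover have "inv\<^bsub>add_monoid (poly_ring n)\<^esub> a = - a" if "a \<in> J" for a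
    using poly_ring_a_inv[of a n] assms(1) that by (auto simp: a_inv_def)
  ultimately show "subgroup J (add_monoid (poly_ring n))"
    using assms by (intro subgroup.intro) auto
qed (use assms in \<open>auto simp: mult.commute\<close>)

lemma monomial_in_carrier:
  "monomial m \<in> carrier (poly_ring n) \<longleftrightarrow> Poly_Mapping.keys m \<subseteq> {1..n}"
  by (simp add: monomial_def poly_ring_carrier_iff)

lemma monomial_add: "monomial (a + b) = monomial a * monomial b"
  by (simp add: monomial_def mult_single)

lemma poly_mapping_sum_single:
  "p = (\<Sum>m\<in>Poly_Mapping.keys p. Poly_Mapping.single m (Poly_Mapping.lookup p m))"
  by (rule poly_mapping_eqI) (simp add: lookup_sum lookup_single when_def in_keys_iff)

lemma ideal_sum_closed:
  assumes "ideal J (poly_ring n)" "\<And>i. i \<in> X \<Longrightarrow> f i \<in> J"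
  shows "sum f X \<in> J"
proof -
  interpret ideal J "poly_ring n" by fact
  have "a + b \<in> J" if "a \<in> J" "b \<in> J" for a b
    using additive_subgroup.a_closed[OF is_additive_subgroup that] by simp
  moreover have "0 \<in> J"
    using additive_subgroup.zero_closed[OF is_additive_subgroup] by simp
  ultimately show ?thesis
    using assms(2) by (induction X rule: infinite_finite_induct) auto
qed

text \<open>The polynomials whose terms are all multiples of generators form an ideal containing the
  generators, so the generated ideal is no larger. Conversely, such a polynomial is the sum of its
  terms, each of which lies in the generated ideal.\<close>

lemma mon_ideal_iff:
  fixes p :: "'k::field mpol"
  assumes T: "\<And>t. t \<in> T \<Longrightarrow> Poly_Mapping.keys t \<subseteq> {1..n}"
  shows "p \<in> mon_ideal n T \<longleftrightarrow>
    p \<in> carrier (poly_ring n) \<and> (\<forall>m\<in>Poly_Mapping.keys p. \<exists>t\<in>T. \<exists>s. m = t + s)"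
proof -
  interpret cring "poly_ring n :: 'k mpol ring" by (rule cring_poly_ring)
  let ?J = "{p \<in> carrier (poly_ring n). \<forall>m\<in>Poly_Mapping.keys p. \<exists>t\<in>T. \<exists>s. m = t + s} :: 'k mpol set"
  have T': "monomial ` T \<subseteq> carrier (poly_ring n :: 'k mpol ring)"
    using T by (auto simp: monomial_in_carrier)
  have "ideal ?J (poly_ring n)"
  proof (rule poly_ring_idealI)
    fix a b :: "'k mpol" assume "a \<in> ?J" "b \<in> ?J"
    then show "a + b \<in> ?J"
      using Poly_Mapping.keys_add[of a b] a_closed[of a b] by auto
  next
    fix a x :: "'k mpol" assume a: "a \<in> ?J" and x: "x \<in> carrier (poly_ring n)"
    have "\<exists>t\<in>T. \<exists>s. m = t + s" if m: "m \<in> Poly_Mapping.keys (x * a)" for m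
    proof -
      obtain b c where "m = b + c" "c \<in> Poly_Mapping.keys a"
        using keys_mult[of x a] m by blast
      moreover from this a obtain t s where "t \<in> T" "c = t + s"
        by blast
      ultimately have "m = t + (s + b)"
        by (simp add: ac_simps)
      with \<open>t \<in> T\<close> show ?thesis by blast
    qed
    then show "x * a \<in> ?J"
      using m_closed[of x a] a x by simp
  qed (auto simp: poly_ring_carrier_iff)
  moreover have "monomial t \<in> ?J" if "t \<in> T" for t
    using T' that by (auto simp: monomial_def intro!: bexI[of _ t] exI[of _ 0])
  ultimately have 1: "mon_ideal n T \<subseteq> ?J"
    unfolding mon_ideal_def by (intro genideal_minimal) auto
  have id: "ideal (mon_ideal n T) (poly_ring n :: 'k mpol ring)"
    unfolding mon_ideal_def by (rule genideal_ideal[OF T'])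
  have "p \<in> mon_ideal n T" if p: "p \<in> ?J"
  proof (subst poly_mapping_sum_single[of p], rule ideal_sum_closed[OF id])
    fix m assume m: "m \<in> Poly_Mapping.keys p"
    then obtain t s where ts: "t \<in> T" "m = t + s"
      using p by blast
    \<comment> \<open>Absorption needs the cofactor to lie in the ring; its variables all occur in
      \<open>m\<close>.\<close>
    have "Poly_Mapping.keys s \<subseteq> Poly_Mapping.keys m"
      by (auto simp: ts in_keys_iff lookup_add)
    then have "Poly_Mapping.single s (Poly_Mapping.lookup p m) \<in> carrier (poly_ring n)"
      using p m by (auto simp: poly_ring_carrier_iff)
    moreover have "(monomial t :: 'k mpol) \<in> mon_ideal n T"
      using genideal_self[OF T'] ts(1) by (auto simp: mon_ideal_def)
    ultimately have "Poly_Mapping.single s (Poly_Mapping.lookup p m) * monomial t \<in> mon_ideal n T"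
      using ideal.I_l_closed[OF id] by simp
    then show "Poly_Mapping.single m (Poly_Mapping.lookup p m) \<in> mon_ideal n T"
      by (simp add: monomial_def mult_single ts(2) add.commute)
  qed
  with 1 show ?thesis by blast
qed

lemma ideal_mon_ideal:
  assumes "\<And>t. t \<in> T \<Longrightarrow> Poly_Mapping.keys t \<subseteq> {1..n}"
  shows "ideal (mon_ideal n T :: 'k::field mpol set) (poly_ring n)"
proof -
  interpret cring "poly_ring n :: 'k mpol ring" by (rule cring_poly_ring)
  show ?thesis
    unfolding mon_ideal_def using assms
    by (intro genideal_ideal) (auto simp: monomial_in_carrier)
qed

subsection \<open>Squarefree monomials\<close>

lemma keys_xvar [simp]: "Poly_Mapping.keys (xvar i) = {i}"
  by (simp add: xvar_def)

lemma lookup_x_set: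
  "finite A \<Longrightarrow> Poly_Mapping.lookup (x_set A) i = (if i \<in> A then 1 else 0)"
  by (simp add: x_set_def xvar_def lookup_sum lookup_single when_def)

lemma keys_x_set [simp]: "finite A \<Longrightarrow> Poly_Mapping.keys (x_set A) = A"
  by (auto simp: in_keys_iff lookup_x_set split: if_splits)

lemma x_set_insert:
  "finite A \<Longrightarrow> i \<notin> A \<Longrightarrow> x_set (insert i A) = xvar i + x_set A"
  by (simp add: x_set_def)

lemma x_set_diff_xvar: "finite A \<Longrightarrow> i \<in> A \<Longrightarrow> x_set A - xvar i = x_set (A - {i})"
  by (metis Diff_iff finite_Diff insertCI insert_Diff x_set_insert add_diff_cancel_left')

lemma x_set_eq_iff: "finite A \<Longrightarrow> finite B \<Longrightarrow> x_set A = x_set B \<longleftrightarrow> A = B"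
  by (metis keys_x_set)

lemma x_set_dvd_iff:
  assumes "finite A"
  shows "(\<exists>s. m = x_set A + s) \<longleftrightarrow> A \<subseteq> Poly_Mapping.keys m"
proof
  assume "A \<subseteq> Poly_Mapping.keys m"
  \<comment> \<open>Subtraction of exponents is truncated, but each index of \<open>A\<close> has
    exponent at least 1 in \<open>m\<close>, so nothing is lost.\<close>
  then have "m = x_set A + (m - x_set A)"
    using assms by (intro poly_mapping_eqI) (auto simp: lookup_add lookup_minus lookup_x_set in_keys_iff)
  then show "\<exists>s. m = x_set A + s" ..
qed (use assms in \<open>auto simp: in_keys_iff lookup_add lookup_x_set\<close>)

lemma xvar_eq_x_set: "xvar i = x_set {i}"
  by (simp add: x_set_def)

lemma mon_degree_x_set: "finite A \<Longrightarrow> mon_degree (x_set A) = card A"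
  by (simp add: mon_degree_def lookup_x_set)

text \<open>Exponents bounded by 1 make a monomial the indicator of its support. This turns
  statements on squarefree monomials into statements on sets.\<close>

lemma sqfree_mons_eq: "sqfree_mons n q = x_set ` {A. A \<subseteq> {1..n} \<and> card A = q}"
proof (intro equalityI subsetI)
  fix m assume m: "m \<in> sqfree_mons n q"
  have "m = x_set (Poly_Mapping.keys m)"
  proof (rule poly_mapping_eqI)
    fix i
    have "Poly_Mapping.lookup m i \<le> 1"
      using m by (simp add: sqfree_mons_def)
    then show "Poly_Mapping.lookup m i = Poly_Mapping.lookup (x_set (Poly_Mapping.keys m)) i"
      by (auto simp: lookup_x_set in_keys_iff)
  qed
  then show "m \<in> x_set ` {A. A \<subseteq> {1..n} \<and> card A = q}"
    using m mon_degree_x_set[of "Poly_Mapping.keys m"] by (auto simp: sqfree_mons_def intro!: image_eqI[of _ _ "Poly_Mapping.keys m"])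
next
  fix m assume "m \<in> x_set ` {A. A \<subseteq> {1..n} \<and> card A = q}"
  then show "m \<in> sqfree_mons n q"
    using finite_subset[of _ "{1..n}"] by (fastforce simp: sqfree_mons_def lookup_x_set mon_degree_x_set)
qed

subsection \<open>Primes generated by variables\<close>

lemma var_prime_iff:
  assumes "C \<subseteq> {1..n}"
  shows "p \<in> var_prime n C \<longleftrightarrow>
    p \<in> carrier (poly_ring n) \<and> (\<forall>m\<in>Poly_Mapping.keys p. Poly_Mapping.keys m \<inter> C \<noteq> {})"
proof -
  have "(\<exists>t\<in>xvar ` C. \<exists>s. m = t + s) \<longleftrightarrow> Poly_Mapping.keys m \<inter> C \<noteq> {}" for m
    using x_set_dvd_iff[of "{i}" m for i] by (auto simp: xvar_eq_x_set)
  then show ?thesis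
    unfolding var_prime_def using assms by (subst mon_ideal_iff) auto
qed

lemma monomial_in_var_prime:
  assumes "C \<subseteq> {1..n}"
  shows "monomial m \<in> var_prime n C \<longleftrightarrow> Poly_Mapping.keys m \<subseteq> {1..n} \<and> Poly_Mapping.keys m \<inter> C \<noteq> {}"
  by (simp add: var_prime_iff[OF assms] monomial_in_carrier) (simp add: monomial_def)

lemma var_prime_subset_iff:
  assumes "C \<subseteq> {1..n}" "D \<subseteq> {1..n}"
  shows "(var_prime n C :: 'k::field mpol set) \<subseteq> var_prime n D \<longleftrightarrow> C \<subseteq> D"
proof
  assume *: "(var_prime n C :: 'k mpol set) \<subseteq> var_prime n D"
  show "C \<subseteq> D"
  proof
    fix i assume "i \<in> C"
    then have "(monomial (xvar i) :: 'k mpol) \<in> var_prime n C"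
      using assms by (auto simp: monomial_in_var_prime)
    with * have "(monomial (xvar i) :: 'k mpol) \<in> var_prime n D"
      by blast
    then show "i \<in> D"
      using assms(2) by (simp add: monomial_in_var_prime)
  qed
next
  assume "C \<subseteq> D"
  then show "(var_prime n C :: 'k mpol set) \<subseteq> var_prime n D"
    unfolding var_prime_iff[OF assms(1)] var_prime_iff[OF assms(2)] subset_iff by blast
qed

lemma var_prime_eq_iff:
  assumes "C \<subseteq> {1..n}" "D \<subseteq> {1..n}"
  shows "(var_prime n C :: 'k::field mpol set) = var_prime n D \<longleftrightarrow> C = D"
  using var_prime_subset_iff[OF assms, where 'k='k] var_prime_subset_iff[OF assms(2,1), where 'k='k]
  by blast

lemma ideal_var_prime:
  "C \<subseteq> {1..n} \<Longrightarrow> ideal (var_prime n C :: 'k::field mpol set) (poly_ring n)"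
  unfolding var_prime_def by (rule ideal_mon_ideal) auto

text \<open>Primality: setting the variables of \<open>C\<close> to zero is the map onto a polynomial ring, which has
  no zero divisors.\<close>

lemma primeideal_var_prime:
  fixes n :: nat
  assumes C: "C \<subseteq> {1..n}"
  shows "primeideal (var_prime n C :: 'k::field mpol set) (poly_ring n)"
proof (rule primeidealI[OF ideal_var_prime[OF C] cring_poly_ring])
  have "(1 :: 'k mpol) \<notin> var_prime n C"
    by (simp add: var_prime_iff[OF C])
  moreover have "(1 :: 'k mpol) \<in> carrier (poly_ring n)"
    by (simp add: poly_ring_carrier_iff)
  ultimately show "carrier (poly_ring n) \<noteq> (var_prime n C :: 'k mpol set)"
    by blast
next
  interpret cring "poly_ring n :: 'k mpol ring" by (rule cring_poly_ring)
  interpret I: ideal "var_prime n C :: 'k mpol set" "poly_ring n"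
    by (rule ideal_var_prime[OF C])
  \<comment> \<open>\<open>b\<close> collects the terms free of the variables of \<open>C\<close>,
    the image of \<open>p\<close> when these are set to zero; the other terms form
    \<open>c\<close>.\<close>
  have split: "\<exists>b c. p = b + c \<and> b \<in> carrier (poly_ring n) \<and> c \<in> var_prime n C
      \<and> (\<forall>m\<in>Poly_Mapping.keys b. Poly_Mapping.keys m \<inter> C = {})"
    if p: "p \<in> carrier (poly_ring n)" for p :: "'k mpol"
  proof -
    define f where "f m = Poly_Mapping.single m (Poly_Mapping.lookup p m)" for m
    let ?K = "{m \<in> Poly_Mapping.keys p. Poly_Mapping.keys m \<inter> C = {}}"
    have k: "Poly_Mapping.keys (sum f X) \<subseteq> X" for X
      using Poly_Mapping.keys_sum[of f X] by (auto simp: f_def split: if_splits)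
    have "p = sum f (Poly_Mapping.keys p)"
      unfolding f_def by (rule poly_mapping_sum_single)
    also have "\<dots> = sum f ?K + sum f (Poly_Mapping.keys p - ?K)"
      by (subst sum.subset_diff[of ?K]) (auto simp: add.commute)
    finally have "p = sum f ?K + sum f (Poly_Mapping.keys p - ?K)" .
    moreover have "sum f ?K \<in> carrier (poly_ring n)"
      using k[of ?K] p unfolding poly_ring_carrier_iff by blast
    moreover have "sum f (Poly_Mapping.keys p - ?K) \<in> var_prime n C"
      using k[of "Poly_Mapping.keys p - ?K"] p
      unfolding var_prime_iff[OF C] poly_ring_carrier_iff by blast
    moreover have "\<forall>m\<in>Poly_Mapping.keys (sum f ?K). Poly_Mapping.keys m \<inter> C = {}"
      using k[of ?K] by blast
    ultimately show ?thesis by blast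
  qed
  fix p r :: "'k mpol"
  assume p: "p \<in> carrier (poly_ring n)" and r: "r \<in> carrier (poly_ring n)"
    and pr: "p \<otimes>\<^bsub>poly_ring n\<^esub> r \<in> var_prime n C"
  obtain b c where b: "p = b + c" "b \<in> carrier (poly_ring n)" "c \<in> var_prime n C"
      "\<forall>m\<in>Poly_Mapping.keys b. Poly_Mapping.keys m \<inter> C = {}"
    using split[OF p] by blast
  obtain d e where d: "r = d + e" "d \<in> carrier (poly_ring n)" "e \<in> var_prime n C"
      "\<forall>m\<in>Poly_Mapping.keys d. Poly_Mapping.keys m \<inter> C = {}"
    using split[OF r] by blast
  have "b * e \<in> var_prime n C" "c * r \<in> var_prime n C"
    using I.I_l_closed[OF d(3) b(2)] I.I_r_closed[OF b(3) r] by simp_all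
  then have "b * e + c * r \<in> var_prime n C"
    using I.a_closed by simp
  \<comment> \<open>This puts \<open>b * d\<close> into the ideal, yet no term of
    \<open>b * d\<close> involves a variable of \<open>C\<close>; hence it vanishes.\<close>
  moreover have "b * d = p * r - (b * e + c * r)"
    unfolding b(1) d(1) by (simp add: algebra_simps)
  ultimately have bd: "b * d \<in> var_prime n C"
    using pr by (auto simp: var_prime_iff[OF C] poly_ring_carrier_iff dest!: subsetD[OF keys_diff])
  have "Poly_Mapping.keys m \<inter> C = {}" if m: "m \<in> Poly_Mapping.keys (b * d)" for m
  proof -
    obtain x y where "m = x + y" "x \<in> Poly_Mapping.keys b" "y \<in> Poly_Mapping.keys d"
      using keys_mult[of b d] m by blast
    then show ?thesis
      using b(4) d(4) Poly_Mapping.keys_add[of x y] by blast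
  qed
  with bd have "Poly_Mapping.keys (b * d) = {}"
    by (auto simp: var_prime_iff[OF C])
  then have "b * d = 0"
    by simp
  then have "b = 0 \<or> d = 0"
    by simp
  then show "p \<in> var_prime n C \<or> r \<in> var_prime n C"
    using b d by auto
qed

subsection \<open>Minimal primes of squarefree monomial ideals\<close>

text \<open>Vertex covers of a hypergraph on \<open>{1..n}\<close> whose edges are the supports of
  the generators. For edges inside \<open>{1..n}\<close>, the complements are the sets that contain
  no edge.\<close>

definition covers :: "nat \<Rightarrow> nat set set \<Rightarrow> nat set \<Rightarrow> bool" where
  "covers n E C \<longleftrightarrow> C \<subseteq> {1..n} \<and> (\<forall>e\<in>E. e \<inter> C \<noteq> {})"

definition min_covers :: "nat \<Rightarrow> nat set set \<Rightarrow> nat set set" where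
  "min_covers n E = {C. covers n E C \<and> (\<forall>D. D \<subset> C \<longrightarrow> \<not> covers n E D)}"

lemma covers_contains_min_cover:
  assumes "covers n E C"
  obtains D where "D \<in> min_covers n E" "D \<subseteq> C"
proof -
  have "finite C"
    using assms finite_subset by (auto simp: covers_def)
  then have "finite {D. D \<subseteq> C \<and> covers n E D}"
    by simp
  moreover have "C \<in> {D. D \<subseteq> C \<and> covers n E D}"
    using assms by simp
  ultimately obtain D where "D \<in> {D. D \<subseteq> C \<and> covers n E D}"
      "\<forall>D'\<in>{D. D \<subseteq> C \<and> covers n E D}. D' \<subseteq> D \<longrightarrow> D = D'"
    by (meson finite_has_minimal2)
  then show ?thesis
    by (intro that[of D]) (auto simp: min_covers_def)
qed

text \<open>Split off one variable at a time by primality; the empty product 1 lies in no prime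
  ideal.\<close>

lemma primeideal_contains_variable:
  fixes P :: "'k::field mpol set"
  assumes P: "primeideal P (poly_ring n)" and W: "W \<subseteq> {1..n}" and "monomial (x_set W) \<in> P"
  shows "\<exists>i\<in>W. monomial (xvar i) \<in> P"
proof -
  interpret primeideal P "poly_ring n" by fact
  have "finite W"
    using W finite_subset by blast
  then show ?thesis
    using W assms(3)
  proof (induction W)
    case empty
    then have "\<one>\<^bsub>poly_ring n\<^esub> \<in> P"
      by (simp add: x_set_def monomial_def)
    then show ?case
      using one_imp_carrier I_notcarr by blast
  next
    case (insert i W)
    have "monomial (xvar i) \<otimes>\<^bsub>poly_ring n\<^esub> monomial (x_set W) \<in> P"
      using insert by (simp add: x_set_insert monomial_add)
    then have "monomial (xvar i) \<in> P \<or> monomial (x_set W) \<in> P"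
      using insert by (intro I_prime) (auto simp: monomial_in_carrier)
    then show ?case
      using insert by auto
  qed
qed

lemma edge_ideal_iff:
  assumes "E \<subseteq> Pow {1..n}"
  shows "p \<in> mon_ideal n (x_set ` E) \<longleftrightarrow>
    p \<in> carrier (poly_ring n) \<and> (\<forall>m\<in>Poly_Mapping.keys p. \<exists>e\<in>E. e \<subseteq> Poly_Mapping.keys m)"
proof -
  have f: "finite e" if "e \<in> E" for e
    using assms that finite_subset by blast
  have "(\<exists>t\<in>x_set ` E. \<exists>s. m = t + s) \<longleftrightarrow> (\<exists>e\<in>E. e \<subseteq> Poly_Mapping.keys m)" for m
    using x_set_dvd_iff[OF f] by auto
  moreover have "Poly_Mapping.keys t \<subseteq> {1..n}" if "t \<in> x_set ` E" for t
    using that f assms by fastforce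
  ultimately show ?thesis
    by (subst mon_ideal_iff) auto
qed

lemma edge_ideal_subset_var_prime:
  assumes "covers n E C" "E \<subseteq> Pow {1..n}"
  shows "mon_ideal n (x_set ` E) \<subseteq> var_prime n C"
  using assms by (fastforce simp: edge_ideal_iff var_prime_iff covers_def)

text \<open>The cover consists of all variables in \<open>P\<close>. It meets every edge because
  \<open>P\<close> contains the corresponding generator and hence one of its factors.\<close>

lemma primeideal_above_edge_ideal:
  fixes P :: "'k::field mpol set"
  assumes P: "primeideal P (poly_ring n)" and E: "E \<subseteq> Pow {1..n}"
    and sub: "mon_ideal n (x_set ` E) \<subseteq> P"
  obtains C where "covers n E C" "var_prime n C \<subseteq> P"
proof
  let ?C = "{i\<in>{1..n}. monomial (xvar i) \<in> P}"
  show "covers n E ?C"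
    unfolding covers_def
  proof (intro conjI ballI)
    fix e assume e: "e \<in> E"
    then have "finite e" "e \<subseteq> {1..n}"
      using E finite_subset by blast+
    then have "monomial (x_set e) \<in> (mon_ideal n (x_set ` E) :: 'k mpol set)"
      using e by (auto simp: edge_ideal_iff[OF E] monomial_in_carrier) (auto simp: monomial_def)
    then have "\<exists>i\<in>e. monomial (xvar i) \<in> P"
      using sub \<open>e \<subseteq> {1..n}\<close> by (intro primeideal_contains_variable[OF P]) auto
    then show "e \<inter> ?C \<noteq> {}"
      using \<open>e \<subseteq> {1..n}\<close> by blast
  qed auto
  interpret cring "poly_ring n :: 'k mpol ring" by (rule cring_poly_ring)
  show "var_prime n ?C \<subseteq> P"
    unfolding var_prime_def mon_ideal_def
    using P by (intro genideal_minimal) (auto dest: primeideal.axioms)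
qed

text \<open>Each prime above the ideal contains \<open>var_prime n C\<close> for some cover
  \<open>C\<close>, which is itself a prime above the ideal. Inclusion among these primes is
  inclusion among the covers, so minimality transfers.\<close>

lemma minimal_primes_edge_ideal:
  assumes E: "E \<subseteq> Pow {1..n}"
  shows "minimal_primes (poly_ring n) (mon_ideal n (x_set ` E) :: 'k::field mpol set)
    = var_prime n ` min_covers n E"
proof (intro equalityI subsetI)
  fix P :: "'k mpol set"
  assume "P \<in> minimal_primes (poly_ring n) (mon_ideal n (x_set ` E))"
  then have P: "primeideal P (poly_ring n)" "mon_ideal n (x_set ` E) \<subseteq> P"
    and min: "\<And>Q. primeideal Q (poly_ring n) \<Longrightarrow> mon_ideal n (x_set ` E) \<subseteq> Q \<Longrightarrow> Q \<subseteq> P \<Longrightarrow> Q = P"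
    by (auto simp: minimal_primes_def)
  obtain C where C: "covers n E C" "var_prime n C \<subseteq> P"
    using primeideal_above_edge_ideal[OF P(1) E P(2)] by blast
  have cov: "var_prime n D = P" if "covers n E D" "var_prime n D \<subseteq> P" for D
    using that edge_ideal_subset_var_prime[OF _ E]
    by (intro min primeideal_var_prime) (auto simp: covers_def)
  have "C \<in> min_covers n E"
    unfolding min_covers_def
  proof (intro CollectI conjI allI impI notI C(1))
    fix D assume D: "D \<subset> C" "covers n E D"
    then have "(var_prime n D :: 'k mpol set) \<subseteq> var_prime n C"
      using C(1) by (subst var_prime_subset_iff) (auto simp: covers_def)
    then have "(var_prime n D :: 'k mpol set) = var_prime n C"
      using cov[of D] cov[of C] C D by blast
    then show False
      using D C(1) by (subst (asm) var_prime_eq_iff) (auto simp: covers_def)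
  qed
  then show "P \<in> var_prime n ` min_covers n E"
    using cov[OF C] by blast
next
  fix P :: "'k mpol set"
  assume "P \<in> var_prime n ` min_covers n E"
  then obtain C where C: "C \<in> min_covers n E" "P = var_prime n C"
    by blast
  then have cov: "covers n E C" and sub: "C \<subseteq> {1..n}"
    by (auto simp: min_covers_def covers_def)
  show "P \<in> minimal_primes (poly_ring n) (mon_ideal n (x_set ` E))"
    unfolding minimal_primes_def
  proof (intro CollectI conjI allI impI)
    show "primeideal P (poly_ring n)"
      using C sub primeideal_var_prime by blast
    show "mon_ideal n (x_set ` E) \<subseteq> P"
      using C cov E edge_ideal_subset_var_prime by blast
    fix Q
    assume "primeideal Q (poly_ring n) \<and> mon_ideal n (x_set ` E) \<subseteq> Q \<and> Q \<subseteq> P"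
    then have Q: "primeideal Q (poly_ring n)" "mon_ideal n (x_set ` E) \<subseteq> Q" "Q \<subseteq> P"
      by auto
    obtain D where D: "covers n E D" "var_prime n D \<subseteq> Q"
      using primeideal_above_edge_ideal[OF Q(1) E Q(2)] by blast
    then have "(var_prime n D :: 'k mpol set) \<subseteq> var_prime n C"
      using Q C by blast
    then have "D \<subseteq> C"
      using D sub by (subst (asm) var_prime_subset_iff) (auto simp: covers_def)
    then have "D = C"
      using C(1) D(1) by (auto simp: min_covers_def)
    then show "Q = P"
      using D Q C by blast
  qed
qed

text \<open>If the support of a term contains no edge, its complement is a cover, and a minimal
  cover inside that complement gives a prime not containing the term.\<close>

lemma minimal_primary_decomposition_edge_ideal:
  assumes E: "E \<subseteq> Pow {1..n}"
  shows "minimal_primary_decomposition (poly_ring n) (mon_ideal n (x_set ` E) :: 'k::field mpol set)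
    (var_prime n ` min_covers n E)"
proof -
  let ?I = "mon_ideal n (x_set ` E) :: 'k mpol set"
  have sub: "C \<subseteq> {1..n}" if "C \<in> min_covers n E" for C
    using that by (auto simp: min_covers_def covers_def)
  have le: "?I \<subseteq> var_prime n C" if "C \<in> min_covers n E" for C
    using that edge_ideal_subset_var_prime[OF _ E] by (auto simp: min_covers_def)
  have "p \<in> ?I" if p: "p \<in> carrier (poly_ring n)" "\<And>C. C \<in> min_covers n E \<Longrightarrow> p \<in> var_prime n C" for p
    unfolding edge_ideal_iff[OF E]
  proof (intro conjI ballI p)
    fix m assume m: "m \<in> Poly_Mapping.keys p"
    show "\<exists>e\<in>E. e \<subseteq> Poly_Mapping.keys m"
    proof (rule ccontr)
      assume *: "\<not> (\<exists>e\<in>E. e \<subseteq> Poly_Mapping.keys m)"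
      have "e \<inter> ({1..n} - Poly_Mapping.keys m) \<noteq> {}" if "e \<in> E" for e
        using * E that by blast
      then have "covers n E ({1..n} - Poly_Mapping.keys m)"
        by (auto simp: covers_def)
      then obtain D where D: "D \<in> min_covers n E" "D \<subseteq> {1..n} - Poly_Mapping.keys m"
        by (rule covers_contains_min_cover)
      then show False
        using p(2)[OF D(1)] m var_prime_iff[OF sub[OF D(1)], of p] by blast
    qed
  qed
  then have "carrier (poly_ring n) \<inter> \<Inter>(var_prime n ` min_covers n E) \<subseteq> ?I"
    by (intro subsetI) simp
  moreover have "?I \<subseteq> carrier (poly_ring n)"
    using edge_ideal_iff[OF E] by blast
  ultimately have "?I = carrier (poly_ring n) \<inter> \<Inter>(var_prime n ` min_covers n E)"
    by (intro equalityI Int_greatest INT_greatest le)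
  moreover have "?I \<noteq> carrier (poly_ring n) \<inter> \<Inter>(var_prime n ` min_covers n E - {var_prime n C})"
    if C: "C \<in> min_covers n E" for C
  proof -
    \<comment> \<open>Witness of irredundancy: \<open>?m\<close> avoids
      \<open>var_prime n C\<close>, but any other minimal cover is not contained in \<open>C\<close>
      and so meets the support of \<open>?m\<close>.\<close>
    let ?m = "monomial (x_set ({1..n} - C)) :: 'k mpol"
    have "?m \<in> var_prime n D" if D: "D \<in> min_covers n E" "D \<noteq> C" for D
    proof -
      have "\<not> D \<subset> C"
        using C D(1) unfolding min_covers_def by blast
      then have "\<not> D \<subseteq> C"
        using D(2) by blast
      then have "({1..n} - C) \<inter> D \<noteq> {}"
        using sub[OF D(1)] by blast
      then show ?thesis
        using sub[OF D(1)] by (simp add: monomial_in_var_prime)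
    qed
    then have "?m \<in> carrier (poly_ring n) \<inter> \<Inter>(var_prime n ` min_covers n E - {var_prime n C})"
      by (auto simp: monomial_in_carrier)
    moreover have "?m \<notin> var_prime n C"
      using sub[OF C] by (simp add: monomial_in_var_prime Int_commute)
    ultimately show ?thesis
      using le[OF C] by blast
  qed
  ultimately show ?thesis
    unfolding minimal_primary_decomposition_def minimal_primes_edge_ideal[OF E] by blast
qed

section \<open>Height of the primes generated by variables\<close>

text \<open>Bounding each exponent separately, rather than the total degree, makes the number of
  monomials the plain power \<open>(M + 1) ^ card V\<close>.\<close>

definition exponent_box :: "nat set \<Rightarrow> nat \<Rightarrow> mon set" where
  "exponent_box V M = {m. Poly_Mapping.keys m \<subseteq> V \<and> (\<forall>i. Poly_Mapping.lookup m i \<le> M)}"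

lemma card_exponent_box:
  assumes "finite V"
  shows "finite (exponent_box V M)" "card (exponent_box V M) = (M + 1) ^ card V"
proof -
  have "bij_betw (\<lambda>m. restrict (Poly_Mapping.lookup m) V) (exponent_box V M) (PiE V (\<lambda>_. {..M}))"
  proof (rule bij_betwI')
    fix m m' assume m: "m \<in> exponent_box V M" "m' \<in> exponent_box V M"
    show "(restrict (Poly_Mapping.lookup m) V = restrict (Poly_Mapping.lookup m') V) = (m = m')"
    proof
      assume eq: "restrict (Poly_Mapping.lookup m) V = restrict (Poly_Mapping.lookup m') V"
      show "m = m'"
      proof (rule poly_mapping_eqI)
        fix i
        show "Poly_Mapping.lookup m i = Poly_Mapping.lookup m' i"
        proof (cases "i \<in> V")
          case True
          then show ?thesis using fun_cong[OF eq, of i] by simp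
        next
          case False
          then have "i \<notin> Poly_Mapping.keys m" "i \<notin> Poly_Mapping.keys m'"
            using m by (auto simp: exponent_box_def)
          then show ?thesis by (simp add: in_keys_iff)
        qed
      qed
    qed simp
  next
    fix f assume f: "f \<in> PiE V (\<lambda>_. {..M})"
    \<comment> \<open>Outside \<open>V\<close> a function of \<open>PiE\<close> is undefined; an
      exponent vector must be 0 there.\<close>
    let ?g = "\<lambda>i. if i \<in> V then f i else 0"
    have "finite {i. ?g i \<noteq> 0}"
      using assms by (rule rev_finite_subset) auto
    then have l: "Poly_Mapping.lookup (Abs_poly_mapping ?g) = ?g"
      by (rule lookup_Abs_poly_mapping)
    have "Abs_poly_mapping ?g \<in> exponent_box V M"
      using f by (auto simp: exponent_box_def l in_keys_iff split: if_splits)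
    moreover have "f = restrict (Poly_Mapping.lookup (Abs_poly_mapping ?g)) V"
      unfolding l using f by (auto simp: PiE_def extensional_def fun_eq_iff)
    ultimately show "\<exists>m\<in>exponent_box V M. f = restrict (Poly_Mapping.lookup m) V" ..
  qed (auto simp: exponent_box_def)
  note b = this
  show "finite (exponent_box V M)"
    using bij_betw_finite[OF b] assms finite_PiE[of V "\<lambda>_. {..M}"] by simp
  show "card (exponent_box V M) = (M + 1) ^ card V"
    using bij_betw_same_card[OF b] assms by (simp add: card_PiE)
qed

text \<open>All \<open>f x\<close> lie in the span of the \<open>card B\<close> monomials with
  exponents in \<open>B\<close>, so more than \<open>card B\<close> of them are linearly dependent
  over the field.\<close>

lemma poly_linear_dependence:
  fixes f :: "'i \<Rightarrow> 'k::field mpol"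
  assumes "finite X" "finite B" "card B < card X"
    and keys: "\<And>x. x \<in> X \<Longrightarrow> Poly_Mapping.keys (f x) \<subseteq> B"
  obtains a where "\<exists>x\<in>X. a x \<noteq> 0" "(\<Sum>x\<in>X. Poly_Mapping.single 0 (a x) * f x) = 0"
proof (cases "inj_on f X")
  case False
  then obtain x y where xy: "x \<in> X" "y \<in> X" "x \<noteq> y" "f x = f y"
    by (auto simp: inj_on_def)
  \<comment> \<open>Linear dependence is a notion for sets, so a repeated member of the family is
    treated apart: its two copies cancel.\<close>
  let ?a = "\<lambda>z. if z = x then 1 else if z = y then - 1 else (0::'k)"
  have "(\<Sum>z\<in>X. Poly_Mapping.single 0 (?a z) * f z) = (\<Sum>z\<in>{x,y}. Poly_Mapping.single 0 (?a z) * f z)"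
    using xy assms(1) by (intro sum.mono_neutral_right) auto
  also have "\<dots> = 0"
    using xy by (simp add: single_uminus)
  finally show ?thesis
    using xy by (intro that[of ?a]) (auto intro!: bexI[of _ x])
next
  case True
  interpret vs: vector_space "\<lambda>(c::'k) (p::'k mpol). Poly_Mapping.single 0 c * p"
    by standard (simp_all add: algebra_simps single_add mult_single flip: mult.assoc)
  let ?B = "(\<lambda>m. Poly_Mapping.single m (1::'k)) ` B"
  have "f ` X \<subseteq> vs.span ?B"
  proof
    fix p assume "p \<in> f ` X"
    then have p: "Poly_Mapping.keys p \<subseteq> B"
      using keys by blast
    have "p = (\<Sum>m\<in>Poly_Mapping.keys p. Poly_Mapping.single 0 (Poly_Mapping.lookup p m) * Poly_Mapping.single m 1)"
      using poly_mapping_sum_single[of p] by (simp add: mult_single)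
    also have "\<dots> \<in> vs.span ?B"
      using p by (intro vs.span_sum vs.span_scale vs.span_base) auto
    finally show "p \<in> vs.span ?B" .
  qed
  moreover have "card ?B \<le> card B"
    using assms(2) card_image_le by blast
  ultimately have "vs.dependent (f ` X)"
    using vs.independent_span_bound[of ?B "f ` X"] assms card_image[OF True] by auto
  then obtain c where c: "\<exists>p\<in>f ` X. c p \<noteq> 0" "(\<Sum>p\<in>f ` X. Poly_Mapping.single 0 (c p) * p) = 0"
    using assms(1) by (auto simp: vs.dependent_finite)
  then show ?thesis
    using that[of "c \<circ> f"] by (auto simp: sum.reindex[OF True] o_def)
qed

text \<open>Exponent bounds add up under multiplication, and each of the \<open>card X\<close>
  factors contributes at most \<open>N * D\<close>.\<close>

lemma power_prod_exponents_bounded: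
  fixes y :: "nat \<Rightarrow> 'k::field mpol"
  assumes y: "\<And>i. i \<in> X \<Longrightarrow> Poly_Mapping.keys (y i) \<subseteq> exponent_box V D" and "finite X"
    and e: "\<And>i. i \<in> X \<Longrightarrow> e i \<le> N"
  shows "Poly_Mapping.keys (\<Prod>i\<in>X. y i ^ e i) \<subseteq> exponent_box V (card X * N * D)"
proof -
  have mult: "Poly_Mapping.keys (p * r) \<subseteq> exponent_box V (M + M')"
    if "Poly_Mapping.keys p \<subseteq> exponent_box V M" "Poly_Mapping.keys r \<subseteq> exponent_box V M'"
    for p r :: "'k mpol" and M M'
  proof
    fix m assume "m \<in> Poly_Mapping.keys (p * r)"
    then obtain a b where "m = a + b" "a \<in> Poly_Mapping.keys p" "b \<in> Poly_Mapping.keys r"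
      using keys_mult[of p r] by blast
    then show "m \<in> exponent_box V (M + M')"
      using that Poly_Mapping.keys_add[of a b]
      by (fastforce simp: exponent_box_def lookup_add intro: add_mono)
  qed
  have mono: "exponent_box V M \<subseteq> exponent_box V M'" if "M \<le> M'" for M M'
    using that by (auto simp: exponent_box_def intro: order_trans)
  have pow: "Poly_Mapping.keys (p ^ k) \<subseteq> exponent_box V (k * D)"
    if "Poly_Mapping.keys p \<subseteq> exponent_box V D" for p :: "'k mpol" and k
  proof (induction k)
    case 0
    show ?case by (simp add: exponent_box_def)
  next
    case (Suc k)
    then show ?case
      using mult[OF that Suc] by simp
  qed
  show ?thesis
    using \<open>finite X\<close> y e
  proof (induction X)
    case empty
    show ?case by (simp add: exponent_box_def)
  next
    case (insert i X)
    have "Poly_Mapping.keys (y i ^ e i) \<subseteq> exponent_box V (N * D)"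
      using pow[of "y i" "e i"] mono[of "e i * D" "N * D"] insert by auto
    moreover have "Poly_Mapping.keys (\<Prod>i\<in>X. y i ^ e i) \<subseteq> exponent_box V (card X * N * D)"
      using insert by simp
    ultimately show ?case
      using mult[of _ "N * D" _ "card X * N * D"] insert by (simp add: algebra_simps)
  qed
qed

text \<open>There are \<open>(N + 1) ^ (n + 1)\<close> power products of \<open>n + 1\<close>
  polynomials with exponents up to \<open>N\<close>, but they involve only about
  \<open>N ^ n\<close> monomials, up to a constant factor. For large \<open>N\<close> they are
  linearly dependent.\<close>

lemma algebraic_dependence:
  fixes y :: "nat \<Rightarrow> 'k::field mpol"
  assumes y: "\<And>i. i \<le> n \<Longrightarrow> y i \<in> carrier (poly_ring n)"
  obtains X a where "finite X" "X \<noteq> {}" "\<forall>e\<in>X. Poly_Mapping.keys e \<subseteq> {..n}"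
    "\<forall>e\<in>X. a e \<noteq> 0"
    "(\<Sum>e\<in>X. Poly_Mapping.single 0 (a e) * (\<Prod>i\<le>n. y i ^ Poly_Mapping.lookup e i)) = 0"
proof -
  let ?L = "\<Union>i\<le>n. \<Union>m\<in>Poly_Mapping.keys (y i). Poly_Mapping.lookup m ` Poly_Mapping.keys m"
  \<comment> \<open>A common bound for all exponents; the inserted 0 keeps \<open>Max\<close>
    meaningful when no variable occurs at all.\<close>
  define D where "D = Max (insert 0 ?L)"
  have "Poly_Mapping.lookup m k \<le> D" if "i \<le> n" "m \<in> Poly_Mapping.keys (y i)" for i m k
  proof (cases "k \<in> Poly_Mapping.keys m")
    case True
    then show ?thesis
      unfolding D_def using that by (intro Max_ge) auto
  next
    case False
    then show ?thesis by (simp add: in_keys_iff)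
  qed
  then have yb: "Poly_Mapping.keys (y i) \<subseteq> exponent_box {1..n} D" if "i \<le> n" for i
    using y[OF that] that by (auto simp: exponent_box_def poly_ring_carrier_iff subset_iff)
  \<comment> \<open>\<open>N\<close> is exactly the constant that splits off when
    \<open>((n + 1) * D + 1) * (N + 1)\<close> is raised to the power \<open>n\<close>, which leaves
    \<open>N * (N + 1) ^ n < (N + 1) ^ (n + 1)\<close>.\<close>
  define N where "N = ((n + 1) * D + 1) ^ n"
  let ?X = "exponent_box {..n} N" and ?B = "exponent_box {1..n} ((n + 1) * N * D)"
  have "(n + 1) * N * D + 1 \<le> ((n + 1) * D + 1) * (N + 1)"
    by (simp add: algebra_simps)
  then have "((n + 1) * N * D + 1) ^ n \<le> (((n + 1) * D + 1) * (N + 1)) ^ n"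
    by (rule power_mono) simp
  also have "\<dots> = N * (N + 1) ^ n"
    by (simp only: N_def power_mult_distrib)
  also have "\<dots> < (N + 1) ^ (n + 1)"
    by simp
  finally have lt: "card ?B < card ?X"
    by (simp add: card_exponent_box)
  have kb: "Poly_Mapping.keys (\<Prod>i\<le>n. y i ^ Poly_Mapping.lookup e i) \<subseteq> ?B" if "e \<in> ?X" for e
    using power_prod_exponents_bounded[of "{..n}" y "{1..n}" D "Poly_Mapping.lookup e" N] yb that
    by (simp add: exponent_box_def)
  obtain a where a: "\<exists>e\<in>?X. a e \<noteq> 0"
      "(\<Sum>e\<in>?X. Poly_Mapping.single 0 (a e) * (\<Prod>i\<le>n. y i ^ Poly_Mapping.lookup e i)) = 0"
    by (rule poly_linear_dependence[OF _ _ lt kb]) (simp_all add: card_exponent_box(1))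
  let ?Y = "{e \<in> ?X. a e \<noteq> 0}"
  have "(\<Sum>e\<in>?Y. Poly_Mapping.single 0 (a e) * (\<Prod>i\<le>n. y i ^ Poly_Mapping.lookup e i)) = 0"
    using a(2) by (subst (asm) sum.mono_neutral_right[of _ ?Y]) (auto simp: card_exponent_box)
  moreover have "finite ?Y"
    using card_exponent_box(1)[of "{..n}" N] by simp
  ultimately show ?thesis
    using a(1) by (intro that[of ?Y a]) (auto simp: exponent_box_def)
qed

section \<open>Length of prime chains\<close>

lemma less_poly_mapping_iff:
  "a < b \<longleftrightarrow> (\<exists>k. Poly_Mapping.lookup a k < Poly_Mapping.lookup b k
      \<and> (\<forall>i<k. Poly_Mapping.lookup a i = Poly_Mapping.lookup b i))"
  by transfer (simp add: less_fun_def)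

lemma constant_in_carrier: "Poly_Mapping.single 0 c \<in> carrier (poly_ring n)"
  by (simp add: poly_ring_carrier_iff)

text \<open>Choose \<open>y i\<close> in the difference of consecutive primes. In an algebraic relation among the \<open>y i\<close>
  the lexicographically smallest term can be isolated: dividing by its power of \<open>y 0\<close> and
  passing to the next prime kills all terms with a larger power of \<open>y 0\<close>, and so on, until
  the nonzero constant coefficient remains.\<close>

lemma poly_ring_prime_chain_length_le:
  fixes C :: "nat \<Rightarrow> 'k::field mpol set"
  assumes prime: "\<And>i. i \<le> l \<Longrightarrow> primeideal (C i) (poly_ring n)"
    and chain: "\<And>i. i < l \<Longrightarrow> C i \<subset> C (Suc i)"
  shows "l \<le> n"
proof (rule ccontr)
  assume "\<not> l \<le> n"
  then have l: "n < l" by simp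
  interpret R: cring "poly_ring n :: 'k mpol ring" by (rule cring_poly_ring)
  have id: "ideal (C i) (poly_ring n)" if "i \<le> l" for i
    using prime[OF that] by (rule primeideal.axioms)
  have "\<exists>y. y \<in> C (Suc i) - C i" if "i \<le> n" for i
    using chain[of i] l that by auto
  then obtain y where y: "\<And>i. i \<le> n \<Longrightarrow> y i \<in> C (Suc i) - C i"
    by metis
  have yc: "y i \<in> carrier (poly_ring n)" if "i \<le> n" for i
    using ideal.Icarr[OF id] y[OF that] l that by (meson DiffD1 Suc_leI le_less_trans)
  obtain X a where X: "finite X" "X \<noteq> {}" "\<forall>e\<in>X. Poly_Mapping.keys e \<subseteq> {..n}"
    "\<forall>e\<in>X. a e \<noteq> 0"
    "(\<Sum>e\<in>X. Poly_Mapping.single 0 (a e) * (\<Prod>i\<le>n. y i ^ Poly_Mapping.lookup e i)) = 0"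
    by (rule algebraic_dependence[OF yc])
  define e0 where "e0 = Min X"
  have e0: "e0 \<in> X"
    using X by (simp add: e0_def)
  \<comment> \<open>\<open>K s\<close> keeps the terms that agree with \<open>e0\<close> in the
    exponents of \<open>y 0\<close>, ..., \<open>y (s - 1)\<close>; \<open>z s e\<close> below is
    the term of \<open>e\<close> with these powers removed.\<close>
  define K where "K s = {e \<in> X. \<forall>i<s. Poly_Mapping.lookup e i = Poly_Mapping.lookup e0 i}" for s
  have fin: "finite (K s)" for s
    using X(1) by (simp add: K_def)
  define z where "z s e = Poly_Mapping.single 0 (a e) * (\<Prod>i\<in>{s..n}. y i ^ Poly_Mapping.lookup e i)" for s e
  have powc: "x ^ k \<in> carrier (poly_ring n)" if "x \<in> carrier (poly_ring n)" for x :: "'k mpol" and k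
  proof (induction k)
    case 0
    show ?case using R.one_closed by simp
  next
    case (Suc k)
    then show ?case using R.m_closed[OF that Suc] by simp
  qed
  have prodc: "(\<Prod>i\<in>Y. y i ^ e i) \<in> carrier (poly_ring n)" if "finite Y" "Y \<subseteq> {..n}" for Y e
    using that
  proof (induction Y)
    case empty
    show ?case using R.one_closed by simp
  next
    case (insert i Y)
    then show ?case using R.m_closed[OF powc[OF yc]] by simp
  qed
  have zc: "z s e \<in> carrier (poly_ring n)" for s e
    unfolding z_def using R.m_closed[OF constant_in_carrier prodc] by simp
  have step: "sum (z s) (K s) \<in> C s" if "s \<le> n + 1" for s
    using that
  proof (induction s)
    case 0
    have "sum (z 0) (K 0) = 0"
      using X(5) by (simp add: K_def z_def atLeast0AtMost)
    then show ?case
      using additive_subgroup.zero_closed[OF ideal.axioms(1)[OF id[of 0]]] by simp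
  next
    case (Suc s)
    then have s: "s \<le> n" "s \<le> l" "Suc s \<le> l" and IH: "sum (z s) (K s) \<in> C s"
      using l by auto
    interpret P: primeideal "C s" "poly_ring n" by (rule prime[OF s(2)])
    interpret P': primeideal "C (Suc s)" "poly_ring n" by (rule prime[OF s(3)])
    let ?m = "Poly_Mapping.lookup e0 s"
    have ge: "?m \<le> Poly_Mapping.lookup e s" if "e \<in> K s" for e
    proof (rule ccontr)
      assume "\<not> ?m \<le> Poly_Mapping.lookup e s"
      then have "e < e0"
        unfolding less_poly_mapping_iff using that by (auto simp: K_def intro: exI[of _ s])
      moreover have "e0 \<le> e"
        using that X(1) by (auto simp: e0_def K_def)
      ultimately show False by simp
    qed
    \<comment> \<open>By \<open>ge\<close> the subtraction of exponents is exact on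
      \<open>K s\<close>: \<open>?w e\<close> is \<open>z s e\<close> divided by the common power
      \<open>y s ^ ?m\<close>.\<close>
    let ?w = "\<lambda>e. y s ^ (Poly_Mapping.lookup e s - ?m) * z (Suc s) e"
    have eq: "z s e = y s ^ ?m * ?w e" if "e \<in> K s" for e
    proof -
      have "{s..n} = insert s {Suc s..n}"
        using s by auto
      then show ?thesis
        using ge[OF that] by (simp add: z_def mult_ac flip: power_add)
    qed
    have wc: "?w e \<in> carrier (poly_ring n)" for e
      using R.m_closed[OF powc[OF yc[OF s(1)]] zc] by simp
    have sumc: "sum ?w (K s) \<in> carrier (poly_ring n)"
      by (rule ideal_sum_closed[OF R.oneideal wc])
    have "y s ^ ?m * sum ?w (K s) \<in> C s"
      using IH eq by (simp add: sum_distrib_left)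
    \<comment> \<open>\<open>C s\<close> is prime and \<open>y s\<close> lies outside it, so powers
      of \<open>y s\<close> cancel.\<close>
    moreover have cancel: "y s ^ k * r \<in> C s \<Longrightarrow> r \<in> C s" if "r \<in> carrier (poly_ring n)" for k r
    proof (induction k)
      case 0
      then show ?case by simp
    next
      case (Suc k)
      have "y s \<otimes>\<^bsub>poly_ring n\<^esub> (y s ^ k * r) \<in> C s"
        using Suc.prems by (simp add: mult.assoc)
      then have "y s ^ k * r \<in> C s"
        using P.I_prime[OF yc[OF s(1)], of "y s ^ k * r"] y[OF s(1)]
          R.m_closed[OF powc[OF yc[OF s(1)]] that] by auto
      then show ?case by (rule Suc.IH)
    qed
    ultimately have 1: "sum ?w (K s) \<in> C (Suc s)"
      using sumc chain[of s] s by auto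
    \<comment> \<open>A strictly larger exponent leaves a factor \<open>y s\<close>, which lies in
      \<open>C (Suc s)\<close>.\<close>
    have "?w e \<in> C (Suc s)" if "e \<in> K s - K (Suc s)" for e
    proof -
      have "Poly_Mapping.lookup e s \<noteq> ?m"
        using that by (auto simp: K_def less_Suc_eq)
      then have "?m < Poly_Mapping.lookup e s"
        using ge[of e] that by auto
      then obtain k where "Poly_Mapping.lookup e s - ?m = Suc k"
        by (metis Suc_diff_Suc)
      then have "?w e = y s * (y s ^ k * z (Suc s) e)"
        by (simp add: mult.assoc)
      moreover have "y s ^ k * z (Suc s) e \<in> carrier (poly_ring n)"
        using R.m_closed[OF powc[OF yc[OF s(1)]] zc] by simp
      ultimately show ?thesis
        using P'.I_r_closed[of "y s" "y s ^ k * z (Suc s) e"] y[OF s(1)] by (metis DiffD1 poly_ring_ops(1))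
    qed
    then have 2: "sum ?w (K s - K (Suc s)) \<in> C (Suc s)"
      by (rule ideal_sum_closed[OF P'.is_ideal])
    have "K (Suc s) \<subseteq> K s"
      by (auto simp: K_def)
    then have "sum ?w (K s) = sum ?w (K s - K (Suc s)) + sum ?w (K (Suc s))"
      using fin by (rule sum.subset_diff)
    moreover have "sum ?w (K (Suc s)) = sum (z (Suc s)) (K (Suc s))"
      by (rule sum.cong) (auto simp: K_def)
    ultimately have 3: "sum (z (Suc s)) (K (Suc s)) = sum ?w (K s) + (- 1) * sum ?w (K s - K (Suc s))"
      by simp
    have "(- 1) * sum ?w (K s - K (Suc s)) \<in> C (Suc s)"
      using P'.I_l_closed[OF 2, of "- 1"] by (simp add: poly_ring_carrier_iff)
    from additive_subgroup.a_closed[OF P'.is_additive_subgroup 1 this] show ?case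
      unfolding 3 poly_ring_ops .
  qed
  \<comment> \<open>No exponent vector of \<open>X\<close> reaches beyond index \<open>n\<close>, so
    only \<open>e0\<close> survives. The product in \<open>z (n + 1) e0\<close> is empty, which puts
    the unit \<open>a e0\<close> into a prime ideal.\<close>
  have "K (n + 1) = {e0}"
  proof -
    have "e = e0" if "e \<in> K (n + 1)" for e
    proof (rule poly_mapping_eqI)
      fix i
      show "Poly_Mapping.lookup e i = Poly_Mapping.lookup e0 i"
      proof (cases "i \<le> n")
        case False
        then have "i \<notin> Poly_Mapping.keys e" "i \<notin> Poly_Mapping.keys e0"
          using X(3) e0 that by (auto simp: K_def)
        then show ?thesis by (simp add: in_keys_iff)
      qed (use that in \<open>auto simp: K_def\<close>)
    qed
    then show ?thesis
      using e0 by (auto simp: K_def)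
  qed
  then have "Poly_Mapping.single 0 (a e0) \<in> C (n + 1)"
    using step[of "n + 1"] by (simp add: z_def)
  then have "Poly_Mapping.single 0 (inverse (a e0)) * Poly_Mapping.single 0 (a e0) \<in> C (n + 1)"
    using ideal.I_l_closed[OF id[of "n + 1"] _ constant_in_carrier] l by simp
  then have "\<one>\<^bsub>poly_ring n\<^esub> \<in> C (n + 1)"
    using X(4) e0 by (simp add: mult_single)
  then show False
    using ideal.one_imp_carrier[OF id[of "n + 1"]] primeideal.I_notcarr[OF prime[of "n + 1"]] l by simp
qed

text \<open>Any chain ending in \<open>var_prime n C\<close> can be prolonged by adjoining the
  remaining \<open>n - card C\<close> variables one by one, and the bound \<open>n\<close> on chains
  leaves at most \<open>card C\<close> steps below. Adjoining the variables of \<open>C\<close> one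
  by one attains this.\<close>

lemma height_var_prime:
  assumes C: "C \<subseteq> {1..n}"
  shows "height (poly_ring n) (var_prime n C :: 'k::field mpol set) = enat (card C)"
proof -
  have fin: "finite C"
    using C finite_subset by blast
  have "l \<le> card C"
    if P: "\<forall>i\<le>l. primeideal (P i) (poly_ring n)" "\<forall>i<l. P i \<subset> P (Suc i)" "P l = var_prime n C"
    for l and P :: "nat \<Rightarrow> 'k mpol set"
  proof -
    have "finite ({1..n} - C)"
      by simp
    then obtain h where h: "bij_betw h {0..<card ({1..n} - C)} ({1..n} - C)"
      using ex_bij_betw_nat_finite by blast
    define Q where "Q i = (if i \<le> l then P i else var_prime n (C \<union> h ` {0..<i - l}))" for i
    \<comment> \<open>At \<open>i = l\<close> both branches give \<open>var_prime n C\<close>, so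
      the two chains fit together.\<close>
    have Q: "Q i = var_prime n (C \<union> h ` {0..<i - l})" if "i \<ge> l" for i
      using that P(3) by (auto simp: Q_def)
    have sub: "C \<union> h ` {0..<i - l} \<subseteq> {1..n}" if "i \<le> l + card ({1..n} - C)" for i
      using C h that by (fastforce simp: bij_betw_def)
    have "l + card ({1..n} - C) \<le> n"
    proof (rule poly_ring_prime_chain_length_le[where C = Q])
      fix i assume "i \<le> l + card ({1..n} - C)"
      then show "primeideal (Q i) (poly_ring n)"
        using P(1) primeideal_var_prime[OF sub] by (auto simp: Q_def)
    next
      fix i assume i: "i < l + card ({1..n} - C)"
      show "Q i \<subset> Q (Suc i)"
      proof (cases "i < l")
        case True
        then show ?thesis using P(2) by (auto simp: Q_def)
      next
        case False
        then have il: "l \<le> i" "l \<le> Suc i" by auto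
        have "h (i - l) \<in> {1..n} - C"
          using h i False by (auto simp: bij_betw_def)
        moreover have "h (i - l) \<notin> h ` {0..<i - l}"
          using h i False inj_on_eq_iff[of h "{0..<card ({1..n} - C)}"]
          by (fastforce simp: bij_betw_def)
        moreover have "{0..<Suc i - l} = insert (i - l) {0..<i - l}"
          using False by auto
        ultimately have "C \<union> h ` {0..<i - l} \<subset> C \<union> h ` {0..<Suc i - l}"
          by auto
        then show ?thesis
          unfolding Q[OF il(1)] Q[OF il(2)] psubset_eq
          using i var_prime_subset_iff[OF sub[of i] sub[of "Suc i"], where 'k='k]
            var_prime_eq_iff[OF sub[of i] sub[of "Suc i"], where 'k='k] by auto
      qed
    qed
    moreover have "card ({1..n} - C) = n - card C" "card C \<le> n"
      using C fin card_mono[OF _ C] by (simp_all add: card_Diff_subset)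
    ultimately show ?thesis by simp
  qed
  moreover have "\<exists>P. (\<forall>i\<le>card C. primeideal (P i :: 'k mpol set) (poly_ring n))
      \<and> (\<forall>i<card C. P i \<subset> P (Suc i)) \<and> P (card C) = var_prime n C"
  proof -
    obtain h where h: "bij_betw h {0..<card C} C"
      using ex_bij_betw_nat_finite[OF fin] by blast
    have sub: "h ` {0..<i} \<subseteq> {1..n}" if "i \<le> card C" for i
      using C h that by (fastforce simp: bij_betw_def)
    have "(var_prime n (h ` {0..<i}) :: 'k mpol set) \<subset> var_prime n (h ` {0..<Suc i})" if "i < card C" for i
    proof -
      have "h i \<notin> h ` {0..<i}"
        using h that inj_on_eq_iff[of h "{0..<card C}"] by (fastforce simp: bij_betw_def)
      then have "h ` {0..<i} \<subset> h ` {0..<Suc i}"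
        by (auto simp: atLeast0_lessThan_Suc)
      then show ?thesis
        unfolding psubset_eq
        using that var_prime_subset_iff[OF sub[of i] sub[of "Suc i"], where 'k='k]
          var_prime_eq_iff[OF sub[of i] sub[of "Suc i"], where 'k='k] by auto
    qed
    then show ?thesis
      using primeideal_var_prime[OF sub] h
      by (intro exI[of _ "\<lambda>i. var_prime n (h ` {0..<i})"]) (auto simp: bij_betw_def)
  qed
  ultimately show ?thesis
    unfolding height_def by (intro antisym Sup_least Sup_upper) auto
qed

section \<open>Lexicographic comparison of sets\<close>

lemma x_set_less_iff:
  assumes "finite A" "finite B"
  shows "x_set A < x_set B \<longleftrightarrow> (\<exists>k. k \<in> B \<and> k \<notin> A \<and> (\<forall>i<k. i \<in> A \<longleftrightarrow> i \<in> B))"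
  using assms by (auto simp: less_poly_mapping_iff lookup_x_set split: if_splits)

text \<open>Complementation keeps the first index of difference and swaps which of the two sets owns
  it.\<close>

lemma x_set_less_iff_complement:
  assumes "finite S" "X \<subseteq> S" "Y \<subseteq> S"
  shows "x_set (S - Y) < x_set (S - X) \<longleftrightarrow> x_set X < x_set Y"
proof -
  have "finite X" "finite Y"
    using assms finite_subset by auto
  moreover have "k \<in> S - X \<and> k \<notin> S - Y \<and> (\<forall>i<k. i \<in> S - Y \<longleftrightarrow> i \<in> S - X) \<longleftrightarrow>
      k \<in> Y \<and> k \<notin> X \<and> (\<forall>i<k. i \<in> X \<longleftrightarrow> i \<in> Y)" for k
    using assms by auto
  ultimately show ?thesis
    using assms(1) by (simp add: x_set_less_iff)
qed

text \<open>If \<open>B\<close> were larger, the first difference would lie beyond the interval, and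
  \<open>B\<close> would contain the interval and one element more.\<close>

lemma x_set_le_interval:
  assumes "finite B" "B \<subseteq> {a..}"
  shows "x_set B \<le> x_set {a..<a + card B}"
proof (rule leI, rule notI)
  assume "x_set {a..<a + card B} < x_set B"
  then obtain k where k: "k \<in> B" "k \<notin> {a..<a + card B}" "\<forall>i<k. i \<in> {a..<a + card B} \<longleftrightarrow> i \<in> B"
    using assms(1) by (auto simp: x_set_less_iff)
  have "a + card B \<le> k"
    using k(1,2) assms(2) by auto
  then have "x \<in> B" if "x \<in> {a..<a + card B}" for x
    using k(3) that by (metis atLeastLessThan_iff order_less_le_trans)
  then have "insert k {a..<a + card B} \<subseteq> B"
    using k(1) by blast
  then have "card (insert k {a..<a + card B}) \<le> card B"
    using assms(1) by (rule card_mono[rotated])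
  then show False
    using k(2) by simp
qed

lemma x_set_insert_le_iff:
  assumes "finite A" "finite B" "i \<notin> A" "i \<notin> B"
  shows "x_set (insert i A) \<le> x_set (insert i B) \<longleftrightarrow> x_set A \<le> x_set B"
  using assms by (simp add: x_set_insert)

lemma x_set_insert_antimono:
  assumes "finite B" "a \<notin> B" "b \<notin> B" "a \<le> b"
  shows "x_set (insert b B) \<le> x_set (insert a B)"
proof (cases "a = b")
  case False
  then have "x_set (insert b B) < x_set (insert a B)"
    using assms by (subst x_set_less_iff) (auto intro!: exI[of _ a])
  then show ?thesis by simp
qed simp

text \<open>\<open>m\<close> is the largest index outside \<open>J\<close>, so
  \<open>insert m J\<close> is the least candidate at the lower end of the shadow of the sets that
  are at least \<open>J\<close>.\<close>

lemma x_set_insert_last_le: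
  assumes J: "J \<subseteq> {1..n}" and W: "W \<subseteq> {1..n}" and card: "card W = card J"
    and le: "x_set J \<le> x_set W" and b: "b \<in> {1..n} - W" and m: "m \<in> {1..n} - J" "{m<..n} \<subseteq> J"
  shows "x_set (insert m J) \<le> x_set (insert b W)"
proof (rule leI, rule notI)
  have fin: "finite J" "finite W"
    using J W finite_subset by blast+
  assume "x_set (insert b W) < x_set (insert m J)"
  then obtain k where k: "k \<in> insert m J" "k \<notin> insert b W"
      "\<forall>i<k. i \<in> insert b W \<longleftrightarrow> i \<in> insert m J"
    using fin by (auto simp: x_set_less_iff)
  show False
  proof (cases "m \<le> k")
    \<comment> \<open>Beyond \<open>m\<close> the set \<open>insert m J\<close> contains everything,
      so \<open>insert b W\<close> would be a subset of it missing \<open>k\<close>, against equal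
      cardinalities.\<close>
    case True
    have "insert b W \<subseteq> insert m J - {k}"
    proof
      fix x assume x: "x \<in> insert b W"
      then have "x \<le> n"
        using W b by auto
      consider "x < k" | "x = k" | "k < x"
        by linarith
      then show "x \<in> insert m J - {k}"
      proof cases
        case 1
        then show ?thesis using k(3) x by blast
      next
        case 2
        then show ?thesis using k x by blast
      next
        case 3
        then have "x \<in> {m<..n}"
          using True \<open>x \<le> n\<close> by simp
        then show ?thesis using m 3 by blast
      qed
    qed
    then have "card (insert b W) \<le> card (insert m J - {k})"
      using fin by (intro card_mono) auto
    also have "\<dots> = card (insert m J) - 1"
      using k(1) by simp
    finally show False
      using fin b m card by simp
  next
    case False
    \<comment> \<open>The first index separating \<open>W\<close> from \<open>J\<close> is the
      smaller of \<open>b\<close> and \<open>k\<close>.\<close>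
    have "x_set W < x_set J"
    proof (cases "b < k")
      case True
      then have "b \<in> J"
        using k False by auto
      moreover have "i \<in> W \<longleftrightarrow> i \<in> J" if "i < b" for i
        using k(3) True False that by (metis insert_iff less_trans not_le order_less_irrefl)
      ultimately show ?thesis
        using fin b by (subst x_set_less_iff) auto
    next
      case b': False
      then show ?thesis
        using fin k False by (subst x_set_less_iff) (auto intro!: exI[of _ k])
    qed
    then show False
      using le by simp
  qed
qed

text \<open>\<open>W\<close> collects the \<open>q\<close> smallest elements of \<open>B\<close> and
  is thus the best candidate for a \<open>q\<close>-subset that is at least
  \<open>v\<close>.\<close>

lemma initial_subset_exists:
  fixes B :: "nat set"
  assumes "finite B" "q \<le> card B"
  shows "\<exists>W\<subseteq>B. card W = q \<and> (\<forall>b\<in>B - W. \<forall>w\<in>W. w < b)"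
  using assms(2)
proof (induction q)
  case 0
  show ?case by (intro exI[of _ "{}"]) auto
next
  case (Suc q)
  then obtain W where W: "W \<subseteq> B" "card W = q" "\<forall>b\<in>B - W. \<forall>w\<in>W. w < b"
    by auto
  have fin: "finite W"
    using W(1) assms(1) finite_subset by blast
  have ne: "B - W \<noteq> {}"
    using W Suc.prems by auto
  let ?m = "Min (B - W)"
  have m: "?m \<in> B - W"
    using ne assms(1) by (intro Min_in) auto
  have "w < b" if b: "b \<in> B - insert ?m W" and w: "w \<in> insert ?m W" for b w
  proof (cases "w = ?m")
    case True
    then have "w \<le> b"
      using b assms(1) by simp
    then show ?thesis
      using b True by force
  qed (use W(3) b w in auto)
  then show ?case
    using W m fin by (intro exI[of _ "insert ?m W"]) auto
qed

section \<open>Minimal covers of completely squarefree lexsegment sets\<close>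

text \<open>For \<open>J = {j\<^sub>1 < \<dots> < j\<^sub>q}\<close>, the set \<open>gap J j\<^sub>t\<close> is the set \<open>A\<^sub>t\<close> of the theorem.\<close>

definition gap :: "nat set \<Rightarrow> nat \<Rightarrow> nat set" where
  "gap J k = {1..k} - {i \<in> J. i < k}"

text \<open>The supports of the members of \<open>L(u, v)\<close>, where \<open>U\<close> and
  \<open>J\<close> are the supports of \<open>u\<close> and \<open>v\<close>.\<close>

definition lex_sets :: "nat \<Rightarrow> nat \<Rightarrow> nat set \<Rightarrow> nat set \<Rightarrow> nat set set" where
  "lex_sets n q U J = {W. W \<subseteq> {1..n} \<and> card W = q \<and> x_set J \<le> x_set W \<and> x_set W \<le> x_set U}"

definition final_lex_sets :: "nat \<Rightarrow> nat \<Rightarrow> nat set \<Rightarrow> nat set set" where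
  "final_lex_sets n q U = {W. W \<subseteq> {1..n} \<and> card W = q \<and> x_set W \<le> x_set U}"

lemma lexseg_eq_image: "lexseg n q (x_set U) (x_set J) = x_set ` lex_sets n q U J"
  by (auto simp: lexseg_def lex_sets_def sqfree_mons_eq)

lemma final_lexseg_eq_image: "final_lexseg n q (x_set U) = x_set ` final_lex_sets n q U"
  by (auto simp: final_lexseg_def final_lex_sets_def sqfree_mons_eq)

text \<open>\<open>F\<close> is the support of \<open>u / x_1\<close> and \<open>J\<close> that of
  \<open>v\<close>; starting at 2 expresses that neither is divisible by \<open>x_1\<close>.\<close>

locale squarefree_lexsegment =
  fixes n q :: nat and F J :: "nat set"
  assumes q: "2 \<le> q" and F: "F \<subseteq> {2..n}" "card F = q - 1"
    and J: "J \<subseteq> {2..n}" "card J = q"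
    and completely: "completely_lexseg n (lexseg n q (x_set (insert 1 F)) (x_set J))"
begin

abbreviation E :: "nat set set" where "E \<equiv> lex_sets n q (insert 1 F) J"

lemma fin: "W \<subseteq> {1..n} \<Longrightarrow> finite W"
  using finite_subset by blast

lemma finF [simp]: "finite F" and finJ [simp]: "finite J"
  using F J finite_subset by blast+

lemma one_notin: "1 \<notin> F" "1 \<notin> J"
  using F J by auto

lemma q_less_n: "q < n"
proof -
  have "q \<le> card {2..n}"
    using J card_mono[of "{2..n}" J] by simp
  then show ?thesis using q by simp
qed

lemma J_subset: "J \<subseteq> {1..n}"
  using J by auto

lemma x_set_less_u:
  assumes "W \<subseteq> {1..n}" "1 \<notin> W"
  shows "x_set W < x_set (insert 1 F)"
proof -
  \<comment> \<open>Here \<open>i\<close> is 0, which lies in no support, so index 1 decides the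
    comparison.\<close>
  have "i \<in> W \<longleftrightarrow> i \<in> insert 1 F" if "i < 1" for i
    using assms F that by auto
  then show ?thesis
    using assms finite_subset[OF assms(1)]
    by (subst x_set_less_iff) (auto intro!: exI[of _ 1])
qed

lemma x_set_greater_v:
  assumes "W \<subseteq> {1..n}" "1 \<in> W"
  shows "x_set J < x_set W"
proof -
  have "i \<in> J \<longleftrightarrow> i \<in> W" if "i < 1" for i
    using assms J that by auto
  then show ?thesis
    using assms finite_subset[OF assms(1)] one_notin
    by (subst x_set_less_iff) (auto intro!: exI[of _ 1])
qed

section \<open>The sets \<open>A_t\<close> and comparison with \<open>v\<close>\<close>

lemma gap_subset: "k \<in> J \<Longrightarrow> gap J k \<subseteq> {1..n}"
  using J by (auto simp: gap_def)

lemma mem_gap: "k \<in> J \<Longrightarrow> k \<in> gap J k" "k \<in> J \<Longrightarrow> 1 \<in> gap J k"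
  using J by (auto simp: gap_def)

text \<open>\<open>gap J l\<close> omits the elements of \<open>J\<close> below \<open>l\<close>, so
  \<open>l\<close> is the only element of \<open>J\<close> in it.\<close>

lemma gap_antichain: "k \<in> J \<Longrightarrow> l \<in> J \<Longrightarrow> gap J k \<subseteq> gap J l \<Longrightarrow> k = l"
  using mem_gap[of k] by (auto simp: gap_def)

text \<open>Up to index \<open>k\<close> the set \<open>W\<close> contains only elements of
  \<open>J\<close>, and it misses \<open>k\<close> itself; hence the first difference belongs to
  \<open>J\<close>.\<close>

lemma disjoint_gap_less:
  assumes "W \<subseteq> {1..n}" "k \<in> J" "W \<inter> gap J k = {}"
  shows "x_set W < x_set J"
proof -
  have k: "k \<notin> W"
    using mem_gap(1) assms by auto
  have "\<not> x_set J < x_set W"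
  proof
    assume "x_set J < x_set W"
    then obtain l where l: "l \<in> W" "l \<notin> J" "\<forall>i<l. i \<in> J \<longleftrightarrow> i \<in> W"
      using assms fin by (auto simp: x_set_less_iff)
    have "k < l"
    proof (rule ccontr)
      assume "\<not> k < l"
      then have "l \<in> gap J k"
        using l assms by (auto simp: gap_def)
      then show False using l assms by auto
    qed
    then show False
      using l k assms by auto
  qed
  moreover have "x_set W \<noteq> x_set J"
    using k assms fin by (auto simp: x_set_eq_iff)
  ultimately show ?thesis by auto
qed

text \<open>Let \<open>W\<close> be the \<open>q\<close> smallest elements of \<open>B\<close>. If
  \<open>W < v\<close> with first difference \<open>k\<close>, an element of \<open>B\<close> in
  \<open>gap J k\<close> lies outside \<open>W\<close>, so all of \<open>W\<close> lies below
  \<open>k\<close>. Then \<open>W\<close> is contained in \<open>J - {k}\<close>, which is too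
  small.\<close>

lemma meets_gaps_contains:
  assumes B: "B \<subseteq> {1..n}" "q \<le> card B" and gaps: "\<And>k. k \<in> J \<Longrightarrow> B \<inter> gap J k \<noteq> {}"
  shows "\<exists>W\<subseteq>B. card W = q \<and> x_set J \<le> x_set W"
proof -
  obtain W where W: "W \<subseteq> B" "card W = q" "\<forall>b\<in>B - W. \<forall>w\<in>W. w < b"
    using initial_subset_exists[OF fin[OF B(1)] B(2)] by blast
  have finW: "finite W"
    using W(1) B(1) fin by auto
  have "\<not> x_set W < x_set J"
  proof
    assume "x_set W < x_set J"
    then obtain k where k: "k \<in> J" "k \<notin> W" "\<forall>i<k. i \<in> W \<longleftrightarrow> i \<in> J"
      using finW by (auto simp: x_set_less_iff)
    obtain b where b: "b \<in> B" "b \<in> gap J k"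
      using gaps[OF k(1)] by blast
    have bk: "b \<le> k" "b < k \<Longrightarrow> b \<notin> J"
      using b(2) by (auto simp: gap_def)
    then have "b \<notin> W"
      using k by (metis le_neq_implies_less)
    then have "w < b" if "w \<in> W" for w
      using W(3) b(1) that by blast
    then have "w < k" if "w \<in> W" for w
      using bk(1) that by (meson less_le_trans)
    then have "W \<subseteq> J - {k}"
      using k by auto
    then have "card W \<le> card (J - {k})"
      by (intro card_mono) auto
    also have "\<dots> < card J"
      using k(1) by (intro psubset_card_mono) auto
    finally show False
      using W J by simp
  qed
  then show ?thesis
    using W by auto
qed

lemma meets_gaps_iff:
  assumes "B \<subseteq> {1..n}" "card B = q"
  shows "x_set J \<le> x_set B \<longleftrightarrow> (\<forall>k\<in>J. B \<inter> gap J k \<noteq> {})"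
proof
  assume "\<forall>k\<in>J. B \<inter> gap J k \<noteq> {}"
  then obtain W where "W \<subseteq> B" "card W = q" "x_set J \<le> x_set W"
    using meets_gaps_contains[of B] assms by auto
  moreover from this have "W = B"
    using assms fin by (intro card_subset_eq) auto
  ultimately show "x_set J \<le> x_set B" by simp
next
  assume "x_set J \<le> x_set B"
  then show "\<forall>k\<in>J. B \<inter> gap J k \<noteq> {}"
    using disjoint_gap_less[OF assms(1)] by (meson leD)
qed

text \<open>The first shadow of the lexsegment contains the largest monomial of degree \<open>q + 1\<close>, hence, being
  a lexsegment itself, it is the shadow of the initial lexsegment determined by \<open>v\<close>.\<close>

lemma contains_lex_set:
  assumes B: "B \<subseteq> {1..n}" "q < card B" and W: "W \<subseteq> B" "card W = q" "x_set J \<le> x_set W"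
  shows "\<exists>W'\<in>E. W' \<subseteq> B"
proof -
  let ?T = "lexseg n q (x_set (insert 1 F)) (x_set J)"
  have finW: "finite W" "finite B"
    using W(1) B(1) fin by auto
  have "W \<noteq> B"
    using B W by auto
  then obtain b where b: "b \<in> B" "b \<notin> W"
    using W(1) by blast
  \<comment> \<open>\<open>x_m v\<close> is the shadow element that bounds the lower end
    \<open>v'\<close> from above.\<close>
  define m where "m = Max ({1..n} - J)"
  have "card ({1..n} - J) = n - q"
    using J J_subset by (simp add: card_Diff_subset)
  then have ne: "{1..n} - J \<noteq> {}"
    using q_less_n by (metis card.empty zero_less_diff less_irrefl)
  then have m: "m \<in> {1..n} - J"
    unfolding m_def by (intro Max_in) auto
  have m': "{m<..n} \<subseteq> J"
  proof
    fix x assume x: "x \<in> {m<..n}"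
    show "x \<in> J"
    proof (rule ccontr)
      assume "x \<notin> J"
      then have "x \<le> m"
        unfolding m_def using x m by (intro Max_ge) auto
      then show False using x by simp
    qed
  qed
  \<comment> \<open>\<open>x_2 ... x_{q+1}\<close> lies between \<open>v\<close> and
    \<open>u\<close>; multiplying it by \<open>x_1\<close> gives the largest squarefree monomial of
    degree \<open>q + 1\<close>.\<close>
  have top: "x_set {1..q + 1} \<in> shadow n ?T"
  proof -
    have "x_set J \<le> x_set {2..<2 + card J}"
      using J by (intro x_set_le_interval) auto
    moreover have "{2..<2 + card J} = {2..q + 1}"
      using J by auto
    ultimately have "{2..q + 1} \<in> E"
      using q_less_n x_set_less_u[of "{2..q + 1}"] by (auto simp: lex_sets_def)
    then have "x_set {2..q + 1} + xvar 1 \<in> shadow n ?T"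
      unfolding shadow_def lexseg_eq_image using q_less_n by fastforce
    moreover have "{1..q + 1} = insert 1 {2..q + 1}"
      by auto
    ultimately show ?thesis
      by (simp add: x_set_insert add.commute)
  qed
  have "J \<in> E"
    using J J_subset x_set_less_u[OF J_subset one_notin(2)] by (auto simp: lex_sets_def)
  then have bot: "x_set (insert m J) \<in> shadow n ?T"
    unfolding shadow_def lexseg_eq_image using m by (fastforce simp: x_set_insert add.commute)
  \<comment> \<open>By \<open>top\<close> the shadow is nonempty, so completeness applies to the
    first iterate.\<close>
  have "is_lexseg n (shadow n ?T)"
    using completely top unfolding completely_lexseg_def by (metis emptyE funpow_0 funpow_simps_right(2) o_apply)
  then obtain r u' v' where uv: "shadow n ?T = lexseg n r u' v'"
    by (auto simp: is_lexseg_def)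
  have "r = q + 1"
    using top mon_degree_x_set[of "{1..q + 1}"] unfolding uv by (simp add: lexseg_def sqfree_mons_def)
  moreover have "insert b W \<subseteq> {1..n}" "card (insert b W) = q + 1"
    using b W B finW by auto
  moreover have "x_set (insert b W) \<le> u'"
  proof -
    have "x_set (insert b W) \<le> x_set {1..<1 + card (insert b W)}"
      using finW \<open>insert b W \<subseteq> {1..n}\<close> by (intro x_set_le_interval) auto
    also have "{1..<1 + card (insert b W)} = {1..q + 1}"
      using \<open>card (insert b W) = q + 1\<close> by auto
    also have "x_set {1..q + 1} \<le> u'"
      using top unfolding uv by (simp add: lexseg_def)
    finally show ?thesis .
  qed
  moreover have "v' \<le> x_set (insert b W)"
  proof -
    have "v' \<le> x_set (insert m J)"
      using bot unfolding uv by (simp add: lexseg_def)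
    also have "\<dots> \<le> x_set (insert b W)"
      using J_subset W B b J m m' by (intro x_set_insert_last_le[of J n W b m]) auto
    finally show ?thesis .
  qed
  ultimately have "x_set (insert b W) \<in> shadow n ?T"
    unfolding uv unfolding lexseg_def sqfree_mons_eq by (intro CollectI conjI imageI) simp_all
  \<comment> \<open>\<open>W\<close> itself may exceed \<open>u\<close>; the member of
    \<open>L(u, v)\<close> inside \<open>insert b W\<close> is obtained by removing a possibly
    different element.\<close>
  then obtain W' i where W': "W' \<in> E" "x_set (insert b W) = x_set W' + xvar i"
    by (auto simp: shadow_def lexseg_eq_image)
  then have "finite W'"
    using fin by (auto simp: lex_sets_def)
  then have "W' \<subseteq> Poly_Mapping.keys (x_set (insert b W))"
    using x_set_dvd_iff W'(2) by blast
  then have "W' \<subseteq> B"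
    using finW W b by auto
  with W' show ?thesis by blast
qed

section \<open>Minimal covers by cardinality\<close>

lemma covers_iff: "covers n E C \<longleftrightarrow> C \<subseteq> {1..n} \<and> (\<forall>W\<in>E. \<not> W \<subseteq> {1..n} - C)"
  unfolding covers_def lex_sets_def by blast

lemma covers_gap: "k \<in> J \<Longrightarrow> covers n E (gap J k)"
  unfolding covers_def using gap_subset disjoint_gap_less[of _ k] by (auto simp: lex_sets_def dest: leD)

lemma card_compl: "C \<subseteq> {1..n} \<Longrightarrow> card ({1..n} - C) = n - card C \<and> card C \<le> n"
  using card_mono[of "{1..n}" C] by (auto simp: card_Diff_subset fin)

text \<open>The complement has more than \<open>q\<close> elements. If it met every gap, it would
  contain a \<open>q\<close>-set that is at least \<open>v\<close>, and then a member of
  \<open>E\<close> by the shadow argument.\<close>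

lemma small_cover_contains_gap:
  assumes "covers n E C" "card C < n - q"
  shows "\<exists>k\<in>J. gap J k \<subseteq> C"
proof (rule ccontr)
  assume *: "\<not> (\<exists>k\<in>J. gap J k \<subseteq> C)"
  let ?B = "{1..n} - C"
  have C: "C \<subseteq> {1..n}"
    using assms by (simp add: covers_def)
  then have card: "q < card ?B"
    using card_compl[OF C] assms(2) by linarith
  have "?B \<inter> gap J k \<noteq> {}" if "k \<in> J" for k
    using * that gap_subset[OF that] by blast
  then obtain W where "W \<subseteq> ?B" "card W = q" "x_set J \<le> x_set W"
    using meets_gaps_contains[of ?B] card by auto
  then obtain W' where "W' \<in> E" "W' \<subseteq> ?B"
    using contains_lex_set[of ?B W] card by auto
  then show False
    using assms(1) unfolding covers_iff by blast
qed

lemma lex_set_card: "W \<in> E \<Longrightarrow> card W = q" "W \<in> E \<Longrightarrow> W \<subseteq> {1..n}"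
  by (auto simp: lex_sets_def)

lemma large_covers:
  assumes "C \<subseteq> {1..n}" "n - q < card C"
  shows "covers n E C"
  unfolding covers_iff
proof (intro conjI ballI notI assms(1))
  fix W assume W: "W \<in> E" "W \<subseteq> {1..n} - C"
  then have "q \<le> card ({1..n} - C)"
    using card_mono[of "{1..n} - C" W] lex_set_card by simp
  then show False
    using card_compl[OF assms(1)] assms(2) by linarith
qed

lemma min_coversI:
  assumes "covers n E C" "\<And>D. covers n E D \<Longrightarrow> D \<subset> C \<Longrightarrow> False"
  shows "C \<in> min_covers n E"
  using assms unfolding min_covers_def by blast

text \<open>The complement \<open>B\<close> of a minimal cover is classified by size: more than
  \<open>q\<close> elements force a gap; with \<open>q\<close> elements \<open>B\<close> lies below
  \<open>v\<close>, giving a gap, or above \<open>u\<close>; with \<open>q - 1\<close> elements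
  every enlargement of \<open>B\<close> must be an edge.\<close>

lemma min_covers_by_size:
  "min_covers n E =
     {gap J k | k. k \<in> J \<and> card (gap J k) \<le> n - q}
     \<union> {{1..n} - B | B. B \<subseteq> {1..n} \<and> card B = q \<and> x_set (insert 1 F) < x_set B}
     \<union> {{1..n} - B | B. B \<subseteq> {1..n} \<and> card B = q - 1 \<and> (\<forall>b\<in>{1..n} - B. insert b B \<in> E)}"
  (is "_ = ?X \<union> ?Y \<union> ?Z")
proof (intro equalityI subsetI)
  fix C assume C: "C \<in> min_covers n E"
  then have cov: "covers n E C" and min: "\<And>D. D \<subset> C \<Longrightarrow> \<not> covers n E D"
    by (auto simp: min_covers_def)
  have sub: "C \<subseteq> {1..n}"
    using cov by (simp add: covers_def)
  let ?B = "{1..n} - C"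
  have CB: "C = {1..n} - ?B"
    using sub by auto
  have gapC: "C \<in> ?X" if "k \<in> J" "gap J k \<subseteq> C" "card C \<le> n - q" for k
  proof -
    have "gap J k = C"
      using min[of "gap J k"] covers_gap that by blast
    then show ?thesis using that by blast
  qed
  have "card C \<le> n - q + 1"
  proof (rule ccontr)
    assume large: "\<not> card C \<le> n - q + 1"
    then obtain c where c: "c \<in> C"
      by fastforce
    \<comment> \<open>More than \<open>n - q\<close> elements always cover, so a cover this large
      can lose an element.\<close>
    have "covers n E (C - {c})"
      using sub large c by (intro large_covers) auto
    then show False
      using min[of "C - {c}"] c by blast
  qed
  then consider "card C < n - q" | "card C = n - q" | "card C = n - q + 1"
    by linarith
  then show "C \<in> ?X \<union> ?Y \<union> ?Z"
  proof cases
    case 1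
    then show ?thesis
      using small_cover_contains_gap[OF cov 1] gapC by auto
  next
    case 2
    have card: "card ?B = q"
      using card_compl[OF sub] 2 q_less_n by linarith
    have "?B \<notin> E"
      using cov unfolding covers_iff by blast
    then consider "x_set ?B < x_set J" | "x_set (insert 1 F) < x_set ?B"
      using card by (fastforce simp: lex_sets_def)
    then show ?thesis
    proof cases
      case less: 1
      then obtain k where "k \<in> J" "?B \<inter> gap J k = {}"
        using meets_gaps_iff[of ?B] card by (auto simp: not_le[symmetric])
      then have "gap J k \<subseteq> C"
        using gap_subset[of k] by blast
      then show ?thesis
        using gapC[OF \<open>k \<in> J\<close>] 2 by simp
    next
      case gr: 2
      then have "C \<in> ?Y"
        using CB card by blast
      then show ?thesis by blast
    qed
  next
    case 3
    have card: "card ?B = q - 1"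
      using card_compl[OF sub] 3 q_less_n by linarith
    have "insert b ?B \<in> E" if "b \<in> {1..n} - ?B" for b
    proof -
      have b: "b \<in> C"
        using that by blast
      then have "\<not> covers n E (C - {b})"
        using min[of "C - {b}"] by blast
      then obtain W where W: "W \<in> E" "W \<subseteq> {1..n} - (C - {b})"
        using sub unfolding covers_iff by blast
      moreover have eq: "{1..n} - (C - {b}) = insert b ?B"
        using b sub by blast
      moreover have "card (insert b ?B) = q"
        using b card q by simp
      ultimately have "W = insert b ?B"
        using lex_set_card(1)[OF W(1)] by (intro card_subset_eq) auto
      then show ?thesis using W by simp
    qed
    then have "C \<in> ?Z"
      using CB card by blast
    then show ?thesis by blast
  qed
next
  fix C assume "C \<in> ?X \<union> ?Y \<union> ?Z"
  then consider k where "C = gap J k" "k \<in> J" "card (gap J k) \<le> n - q"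
    | B where "C = {1..n} - B" "B \<subseteq> {1..n}" "card B = q" "x_set (insert 1 F) < x_set B"
    | B where "C = {1..n} - B" "B \<subseteq> {1..n}" "card B = q - 1" "\<forall>b\<in>{1..n} - B. insert b B \<in> E"
    by blast
  then show "C \<in> min_covers n E"
  proof cases
    case (1 k)
    show ?thesis
    proof (rule min_coversI)
      show "covers n E C"
        using 1 covers_gap by simp
      fix D assume D: "covers n E D" "D \<subset> C"
      then have "card D < card C"
        using 1 gap_subset[of k] fin by (intro psubset_card_mono) auto
      \<comment> \<open>\<open>D\<close> has fewer than \<open>n - q\<close> elements and hence
        contains a gap, which would be strictly inside \<open>gap J k\<close>.\<close>
      then obtain l where "l \<in> J" "gap J l \<subseteq> D"
        using small_cover_contains_gap[OF D(1)] 1 by auto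
      then show False
        using gap_antichain[of l k] D 1 by blast
    qed
  next
    case (2 B)
    have BC: "{1..n} - C = B"
      using 2 by blast
    have card: "card C = n - q"
      using 2 card_compl[of B] by simp
    show ?thesis
    proof (rule min_coversI)
      show "covers n E C"
        unfolding covers_iff BC
      proof (intro conjI ballI notI)
        fix W assume W: "W \<in> E" "W \<subseteq> B"
        then have "W = B"
          using 2 fin lex_set_card(1)[OF W(1)] by (intro card_subset_eq) auto
        then show False
          using W 2 by (auto simp: lex_sets_def)
      qed (use 2 in auto)
      fix D assume D: "covers n E D" "D \<subset> C"
      then have "card D < card C"
        using 2 fin[of C] by (intro psubset_card_mono) auto
      then obtain l where l: "l \<in> J" "gap J l \<subseteq> D"
        using small_cover_contains_gap[OF D(1)] card by auto
      then have "B \<inter> gap J l = {}"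
        using D 2 by blast
      \<comment> \<open>A smaller cover would place \<open>B\<close> below \<open>v\<close>, hence
        below \<open>u\<close>.\<close>
      then have "x_set B < x_set J"
        using disjoint_gap_less 2 l by blast
      also have "\<dots> < x_set (insert 1 F)"
        using x_set_less_u[OF J_subset one_notin(2)] .
      finally show False
        using 2 by simp
    qed
  next
    case (3 B)
    have card: "card C = n - q + 1"
      using 3 card_compl[of B] q q_less_n by simp
    show ?thesis
    proof (rule min_coversI)
      show "covers n E C"
        using 3 card by (intro large_covers) auto
      fix D assume D: "covers n E D" "D \<subset> C"
      then obtain b where b: "b \<in> C" "b \<notin> D"
        by blast
      then have "insert b B \<in> E" "insert b B \<subseteq> {1..n} - D"
        using 3 D by auto
      then show False
        using D(1) unfolding covers_iff by blast
    qed
  qed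
qed

text \<open>\<open>L^f(u)\<close> contains every \<open>q\<close>-set avoiding 1. If
  \<open>card D < n - q\<close>, the complement of \<open>D\<close> keeps \<open>q\<close> elements
  after 1 is dropped, so \<open>D\<close> is no cover. Thus every cover with \<open>n - q\<close>
  elements is minimal, and its complement is a \<open>q\<close>-set above \<open>u\<close>.\<close>

lemma min_covers_final:
  "{C \<in> min_covers n (final_lex_sets n q (insert 1 F)). card C = n - q} =
     {{1..n} - B | B. B \<subseteq> {1..n} \<and> card B = q \<and> x_set (insert 1 F) < x_set B}"
proof (intro equalityI subsetI)
  let ?E = "final_lex_sets n q (insert 1 F)"
  have cov_iff: "covers n ?E C \<longleftrightarrow> C \<subseteq> {1..n} \<and> (\<forall>W\<in>?E. \<not> W \<subseteq> {1..n} - C)" for C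
    unfolding covers_def final_lex_sets_def by blast
  {
    fix C assume "C \<in> {C \<in> min_covers n ?E. card C = n - q}"
    then have C: "covers n ?E C" "card C = n - q"
      by (auto simp: min_covers_def)
    then have sub: "C \<subseteq> {1..n}"
      by (simp add: covers_def)
    have card: "card ({1..n} - C) = q"
      using card_compl[OF sub] C(2) q_less_n by linarith
    have "{1..n} - C \<notin> ?E"
      using C(1) unfolding cov_iff by blast
    then have "x_set (insert 1 F) < x_set ({1..n} - C)"
      using card by (fastforce simp: final_lex_sets_def)
    moreover have "C = {1..n} - ({1..n} - C)"
      using sub by blast
    ultimately show "C \<in> {{1..n} - B | B. B \<subseteq> {1..n} \<and> card B = q \<and> x_set (insert 1 F) < x_set B}"
      using card by blast
  next
    fix C assume "C \<in> {{1..n} - B | B. B \<subseteq> {1..n} \<and> card B = q \<and> x_set (insert 1 F) < x_set B}"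
    then obtain B where B: "C = {1..n} - B" "B \<subseteq> {1..n}" "card B = q" "x_set (insert 1 F) < x_set B"
      by blast
    have BC: "{1..n} - C = B"
      using B by blast
    have card: "card C = n - q"
      using B card_compl[of B] by simp
    have "covers n ?E C"
      unfolding cov_iff BC
    proof (intro conjI ballI notI)
      fix W assume W: "W \<in> ?E" "W \<subseteq> B"
      then have "W = B"
        using B fin by (intro card_subset_eq) (auto simp: final_lex_sets_def)
      then show False
        using W B by (auto simp: final_lex_sets_def)
    qed (use B in auto)
    moreover have "\<not> covers n ?E D" if "D \<subset> C" for D
    proof -
      have D: "D \<subseteq> {1..n}"
        using that B by blast
      have "card D < card C"
        using that B fin[of C] by (intro psubset_card_mono) auto
      then have "q < card ({1..n} - D)"
        using card card_compl[OF D] by linarith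
      then have "q \<le> card ({1..n} - D - {1})"
        by (cases "1 \<in> {1..n} - D") (auto simp: card_Diff_singleton_if)
      then obtain W where W: "W \<subseteq> {1..n} - D - {1}" "card W = q"
        by (meson obtain_subset_with_card_n)
      then have W': "W \<subseteq> {1..n}" "1 \<notin> W"
        by blast+
      then have "W \<in> ?E"
        using W(2) x_set_less_u[OF W'] by (auto simp: final_lex_sets_def)
      then show ?thesis
        using W unfolding cov_iff by blast
    qed
    ultimately show "C \<in> {C \<in> min_covers n ?E. card C = n - q}"
      using card by (auto simp: min_covers_def)
  }
qed

section \<open>Minimal covers with \<open>n - q + 1\<close> elements\<close>

text \<open>If \<open>B\<close> misses \<open>gap J k\<close>, every added \<open>b\<close> must lie
  in that gap, so the gap is the whole complement of \<open>B\<close>. Conversely, by the antichain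
  property, each other gap then already meets \<open>B\<close>.\<close>

lemma le_insert_iff:
  assumes B: "B \<subseteq> {1..n}" "card B = q - 1"
  shows "(\<forall>b\<in>{1..n} - B. x_set J \<le> x_set (insert b B)) \<longleftrightarrow>
    (\<forall>k\<in>J. B \<inter> gap J k \<noteq> {}) \<or> (\<exists>k\<in>J. {1..n} - B = gap J k)"
proof -
  have ins: "x_set J \<le> x_set (insert b B) \<longleftrightarrow> (\<forall>k\<in>J. insert b B \<inter> gap J k \<noteq> {})" if "b \<in> {1..n} - B" for b
    using that B q fin[OF B(1)] by (intro meets_gaps_iff) auto
  show ?thesis
  proof
    assume *: "\<forall>b\<in>{1..n} - B. x_set J \<le> x_set (insert b B)"
    have "{1..n} - B = gap J k" if k: "k \<in> J" "B \<inter> gap J k = {}" for k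
    proof
      show "{1..n} - B \<subseteq> gap J k"
        using * ins k by blast
      show "gap J k \<subseteq> {1..n} - B"
        using gap_subset[OF k(1)] k by blast
    qed
    then show "(\<forall>k\<in>J. B \<inter> gap J k \<noteq> {}) \<or> (\<exists>k\<in>J. {1..n} - B = gap J k)"
      by blast
  next
    assume *: "(\<forall>k\<in>J. B \<inter> gap J k \<noteq> {}) \<or> (\<exists>k\<in>J. {1..n} - B = gap J k)"
    show "\<forall>b\<in>{1..n} - B. x_set J \<le> x_set (insert b B)"
    proof
      fix b assume b: "b \<in> {1..n} - B"
      have "insert b B \<inter> gap J l \<noteq> {}" if l: "l \<in> J" for l
        using *
      proof
        assume "\<exists>k\<in>J. {1..n} - B = gap J k"
        then obtain k where k: "k \<in> J" "{1..n} - B = gap J k" by blast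
        show ?thesis
        proof (cases "l = k")
          case True
          then show ?thesis using b k by blast
        next
          case False
          then have "\<not> gap J l \<subseteq> gap J k"
            using gap_antichain l k by blast
          then show ?thesis
            using k gap_subset[OF l] by blast
        qed
      qed (use l in blast)
      then show "x_set J \<le> x_set (insert b B)"
        using ins[OF b] by blast
    qed
  qed
qed

text \<open>Only \<open>b = 1\<close> is critical: any other enlargement still omits 1 and is below
  \<open>u\<close>. For \<open>b = 1\<close> the common factor \<open>x_1\<close> cancels.\<close>

lemma insert_le_iff_notin:
  assumes B: "B \<subseteq> {1..n}" "1 \<notin> B"
  shows "(\<forall>b\<in>{1..n} - B. x_set (insert b B) \<le> x_set (insert 1 F)) \<longleftrightarrow> x_set B \<le> x_set F"
proof -
  have "x_set (insert b B) \<le> x_set (insert 1 F)" if "b \<in> {1..n} - B" "b \<noteq> 1" for b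
    using x_set_less_u[of "insert b B"] that B by auto
  moreover have "x_set (insert 1 B) \<le> x_set (insert 1 F) \<longleftrightarrow> x_set B \<le> x_set F"
    using B fin one_notin by (intro x_set_insert_le_iff) auto
  moreover have "1 \<in> {1..n} - B"
    using B q_less_n by auto
  ultimately show ?thesis by metis
qed

text \<open>The largest enlargement of \<open>B\<close> adds the smallest available index; the
  common factor \<open>x_1\<close> cancels.\<close>

lemma insert_le_iff_in:
  assumes B: "B \<subseteq> {1..n}" "1 \<in> B" "card B = q - 1"
  shows "(\<forall>b\<in>{1..n} - B. x_set (insert b B) \<le> x_set (insert 1 F)) \<longleftrightarrow>
    x_set (insert (Min ({1..n} - B)) (B - {1})) \<le> x_set F"
proof -
  let ?m = "Min ({1..n} - B)"
  have "card ({1..n} - B) \<noteq> 0"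
    using card_compl[OF B(1)] B(3) q_less_n by linarith
  then have ne: "{1..n} - B \<noteq> {}"
    by (metis card.empty)
  have m: "?m \<in> {1..n} - B"
    using ne by (intro Min_in) auto
  have finB: "finite B"
    using B fin by blast
  have "x_set (insert b B) \<le> x_set (insert 1 F) \<longleftrightarrow> x_set (insert b (B - {1})) \<le> x_set F"
    if "b \<in> {1..n} - B" for b
  proof -
    have "insert b B = insert 1 (insert b (B - {1}))"
      using B by blast
    moreover have "b \<noteq> 1"
      using that B by blast
    ultimately show ?thesis
      using x_set_insert_le_iff[of "insert b (B - {1})" F 1] finB one_notin by simp
  qed
  moreover have "x_set (insert b (B - {1})) \<le> x_set (insert ?m (B - {1}))" if "b \<in> {1..n} - B" for b
    using that m finB by (intro x_set_insert_antimono) auto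
  ultimately show ?thesis
    using m by (meson order_trans)
qed

text \<open>The other elements of \<open>J\<close> avoid \<open>gap J k\<close>, and at this size
  there is room for nothing else. Hence the condition on \<open>v / x_{j_t}\<close>.\<close>

lemma compl_gap:
  assumes "k \<in> J" "card (gap J k) = n - q + 1"
  shows "{1..n} - gap J k = J - {k}"
proof -
  have "J - {k} \<subseteq> {1..n} - gap J k"
    using J_subset by (auto simp: gap_def)
  moreover have "card (J - {k}) = card ({1..n} - gap J k)"
    using assms J card_compl[OF gap_subset[OF assms(1)]] q_less_n q by simp
  ultimately show ?thesis
    by (metis card_subset_eq finite_Diff finite_atLeastAtMost)
qed

text \<open>The two alternatives of \<open>le_insert_iff\<close> yield the two families: the
  complement of \<open>B\<close> is a gap, with \<open>B = J - {k}\<close>, or \<open>B\<close>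
  meets every gap.\<close>

lemma top_covers_notin_one:
  "{{1..n} - B | B. B \<subseteq> {1..n} \<and> 1 \<notin> B \<and> card B = q - 1 \<and> (\<forall>b\<in>{1..n} - B. insert b B \<in> E)} =
     {gap J k | k. k \<in> J \<and> card (gap J k) = n - q + 1 \<and> x_set (J - {k}) \<le> x_set F}
     \<union> {{1..n} - G | G. G \<subseteq> {1..n} - {1} \<and> card G = q - 1
          \<and> (\<forall>k\<in>J. G \<inter> gap J k \<noteq> {}) \<and> x_set G \<le> x_set F}" (is "?L = ?X \<union> ?Y")
proof -
  have E_iff: "(\<forall>b\<in>{1..n} - B. insert b B \<in> E) \<longleftrightarrow>
      ((\<forall>k\<in>J. B \<inter> gap J k \<noteq> {}) \<or> (\<exists>k\<in>J. {1..n} - B = gap J k)) \<and> x_set B \<le> x_set F"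
    if B: "B \<subseteq> {1..n}" "1 \<notin> B" "card B = q - 1" for B
  proof -
    have "insert b B \<in> E \<longleftrightarrow> x_set J \<le> x_set (insert b B) \<and> x_set (insert b B) \<le> x_set (insert 1 F)"
      if "b \<in> {1..n} - B" for b
      using that B q fin[OF B(1)] by (auto simp: lex_sets_def)
    then show ?thesis
      unfolding le_insert_iff[OF B(1,3), symmetric] insert_le_iff_notin[OF B(1,2), symmetric] by blast
  qed
  show ?thesis
  proof (intro equalityI subsetI)
    fix C assume "C \<in> ?L"
    then obtain B where B: "C = {1..n} - B" "B \<subseteq> {1..n}" "1 \<notin> B" "card B = q - 1"
        "\<forall>b\<in>{1..n} - B. insert b B \<in> E"
      by blast
    then have le: "x_set B \<le> x_set F"
      and *: "(\<forall>k\<in>J. B \<inter> gap J k \<noteq> {}) \<or> (\<exists>k\<in>J. {1..n} - B = gap J k)"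
      using E_iff by blast+
    from * show "C \<in> ?X \<union> ?Y"
    proof
      assume "\<forall>k\<in>J. B \<inter> gap J k \<noteq> {}"
      then have "C \<in> ?Y"
        using B le by blast
      then show ?thesis by blast
    next
      assume "\<exists>k\<in>J. {1..n} - B = gap J k"
      then obtain k where k: "k \<in> J" "{1..n} - B = gap J k"
        by blast
      then have card: "card (gap J k) = n - q + 1"
        using card_compl[OF B(2)] B(4) q q_less_n by simp
      have "B = {1..n} - gap J k"
        using B(2) k by blast
      then have "B = J - {k}"
        using compl_gap[OF k(1) card] by simp
      then have "C \<in> ?X"
        using B(1) k card le by blast
      then show ?thesis by blast
    qed
  next
    fix C assume "C \<in> ?X \<union> ?Y"
    then show "C \<in> ?L"
    proof
      assume "C \<in> ?X"
      then obtain k where k: "C = gap J k" "k \<in> J" "card (gap J k) = n - q + 1" "x_set (J - {k}) \<le> x_set F"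
        by blast
      let ?B = "J - {k}"
      have B: "?B \<subseteq> {1..n}" "1 \<notin> ?B" "card ?B = q - 1"
        using J J_subset one_notin k by auto
      have C: "{1..n} - ?B = gap J k"
        using compl_gap[OF k(2,3)] gap_subset[OF k(2)] by blast
      then have "\<forall>b\<in>{1..n} - ?B. insert b ?B \<in> E"
        using E_iff[OF B] k by blast
      with B C k show "C \<in> ?L" by blast
    next
      assume "C \<in> ?Y"
      then obtain G where G: "C = {1..n} - G" "G \<subseteq> {1..n} - {1}" "card G = q - 1"
          "\<forall>k\<in>J. G \<inter> gap J k \<noteq> {}" "x_set G \<le> x_set F"
        by blast
      then have "\<forall>b\<in>{1..n} - G. insert b G \<in> E"
        using E_iff[of G] by blast
      with G show "C \<in> ?L" by blast
    qed
  qed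
qed

text \<open>Since 1 lies in \<open>B\<close>, every enlargement exceeds \<open>v\<close>. The bound
  by \<open>u\<close> concerns the enlargement by \<open>Min G\<close>, and passing to complements
  in \<open>{2..n}\<close> turns it into the condition on \<open>G - {Min G}\<close>.\<close>

lemma top_covers_in_one:
  "{{1..n} - B | B. B \<subseteq> {1..n} \<and> 1 \<in> B \<and> card B = q - 1 \<and> (\<forall>b\<in>{1..n} - B. insert b B \<in> E)} =
     {G. G \<subseteq> {1..n} - {1} \<and> card G = n - q + 1
        \<and> x_set (({1..n} - F) - {1}) \<le> x_set (G - {Min G})}" (is "?L = ?R")
proof -
  have iff: "(\<forall>b\<in>{1..n} - B. insert b B \<in> E) \<longleftrightarrow>
      x_set (({1..n} - F) - {1}) \<le> x_set ({1..n} - B - {Min ({1..n} - B)})"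
    if B: "B \<subseteq> {1..n}" "1 \<in> B" "card B = q - 1" for B
  proof -
    let ?m = "Min ({1..n} - B)" and ?S = "{1..n} - {1}"
    have E: "insert b B \<in> E \<longleftrightarrow> x_set (insert b B) \<le> x_set (insert 1 F)" if b: "b \<in> {1..n} - B" for b
    proof -
      have "x_set J < x_set (insert b B)"
        using b B by (intro x_set_greater_v) auto
      then show ?thesis
        using b B q fin[OF B(1)] by (auto simp: lex_sets_def)
    qed
    have "card ({1..n} - B) \<noteq> 0"
      using card_compl[OF B(1)] B(3) q_less_n by linarith
    then have "{1..n} - B \<noteq> {}"
      by (metis card.empty)
    then have m: "?m \<in> {1..n} - B"
      by (intro Min_in) auto
    let ?X = "insert ?m (B - {1})"
    have "({1..n} - F) - {1} = ?S - F" "{1..n} - B - {?m} = ?S - ?X"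
      using B by blast+
    moreover have "F \<subseteq> ?S" "?X \<subseteq> ?S"
      using F m B by auto
    then have "x_set (?S - ?X) < x_set (?S - F) \<longleftrightarrow> x_set F < x_set ?X"
      by (intro x_set_less_iff_complement) auto
    ultimately have "x_set (({1..n} - F) - {1}) \<le> x_set ({1..n} - B - {?m}) \<longleftrightarrow> x_set ?X \<le> x_set F"
      by (simp only: not_less[symmetric])
    also have "\<dots> \<longleftrightarrow> (\<forall>b\<in>{1..n} - B. insert b B \<in> E)"
      using insert_le_iff_in[OF B] E by blast
    finally show ?thesis by blast
  qed
  show ?thesis
  proof (intro equalityI subsetI)
    fix C assume "C \<in> ?L"
    then obtain B where B: "C = {1..n} - B" "B \<subseteq> {1..n}" "1 \<in> B" "card B = q - 1"
        "\<forall>b\<in>{1..n} - B. insert b B \<in> E"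
      by blast
    moreover have "card C = n - q + 1"
      using B card_compl[OF B(2)] q q_less_n by simp
    ultimately show "C \<in> ?R"
      using iff[OF B(2-4)] by blast
  next
    fix G assume "G \<in> ?R"
    then have G: "G \<subseteq> {1..n} - {1}" "card G = n - q + 1"
        "x_set (({1..n} - F) - {1}) \<le> x_set (G - {Min G})"
      by blast+
    let ?B = "{1..n} - G"
    have GB: "{1..n} - ?B = G" and sub: "G \<subseteq> {1..n}"
      using G(1) by blast+
    have B: "?B \<subseteq> {1..n}" "1 \<in> ?B" "card ?B = q - 1"
      using G card_compl[OF sub] q_less_n by auto
    have "\<forall>b\<in>{1..n} - ?B. insert b ?B \<in> E"
      using iff[OF B] G(3) unfolding GB by blast
    then show "G \<in> ?L"
      using B GB by blast
  qed
qed

text \<open>Some enlargement of \<open>B\<close> contains both 1 and 2 and therefore exceeds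
  \<open>u\<close>, whose support lacks 2.\<close>

lemma top_covers_in_one_empty:
  assumes "2 \<notin> F" "B \<subseteq> {1..n}" "1 \<in> B" "card B = q - 1" "\<forall>b\<in>{1..n} - B. insert b B \<in> E"
  shows False
proof -
  have "card ({1..n} - B) \<noteq> 0"
    using card_compl[OF assms(2)] assms(4) q_less_n by linarith
  then obtain c where c: "c \<in> {1..n} - B"
    by (metis card.empty ex_in_conv)
  let ?b = "if 2 \<in> B then c else 2"
  have b: "?b \<in> {1..n} - B"
    using c q q_less_n by auto
  have two: "2 \<in> insert ?b B" "2 \<notin> insert 1 F"
    using assms(1) by auto
  have "insert ?b B \<in> E"
    using assms(5) b by blast
  then have sub: "insert ?b B \<subseteq> {1..n}" and le: "x_set (insert ?b B) \<le> x_set (insert 1 F)"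
    unfolding lex_sets_def by blast+
  have agree: "i \<in> insert 1 F \<longleftrightarrow> i \<in> insert ?b B" if "i < 2" for i
  proof -
    consider "i = 0" | "i = 1"
      using \<open>i < 2\<close> by fastforce
    then show ?thesis
    proof cases
      case 1
      then have "i \<notin> {1..n}" "i \<notin> {2..n}" "i \<noteq> 1"
        by simp_all
      then show ?thesis using F sub by blast
    next
      case 2
      then show ?thesis using assms(3) by blast
    qed
  qed
  have "x_set (insert 1 F) < x_set (insert ?b B)"
    unfolding x_set_less_iff[OF finite.insertI[OF finF] fin[OF sub]] using two agree by blast
  then show False
    using le by simp
qed

section \<open>Assembling the families of minimal covers\<close>

lemma min_covers_split:
  "min_covers n E =
     {gap J k | k. k \<in> J \<and> card (gap J k) \<le> n - q}
     \<union> {C \<in> min_covers n (final_lex_sets n q (insert 1 F)). card C = n - q}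
     \<union> ({{1..n} - B | B. B \<subseteq> {1..n} \<and> 1 \<notin> B \<and> card B = q - 1 \<and> (\<forall>b\<in>{1..n} - B. insert b B \<in> E)}
     \<union> {{1..n} - B | B. B \<subseteq> {1..n} \<and> 1 \<in> B \<and> card B = q - 1 \<and> (\<forall>b\<in>{1..n} - B. insert b B \<in> E)})"
  unfolding min_covers_by_size min_covers_final by blast

theorem min_covers_lex_sets:
  "min_covers n E =
     {gap J k | k. k \<in> J \<and> card (gap J k) \<le> n - q}
     \<union> {gap J k | k. k \<in> J \<and> card (gap J k) = n - q + 1 \<and> x_set (J - {k}) \<le> x_set F}
     \<union> {{1..n} - G | G. G \<subseteq> {1..n} - {1} \<and> card G = q - 1
          \<and> (\<forall>k\<in>J. G \<inter> gap J k \<noteq> {}) \<and> x_set G \<le> x_set F}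
     \<union> {G. G \<subseteq> {1..n} - {1} \<and> card G = n - q + 1
          \<and> x_set (({1..n} - F) - {1}) \<le> x_set (G - {Min G})}
     \<union> {C \<in> min_covers n (final_lex_sets n q (insert 1 F)). card C = n - q}"
  unfolding min_covers_split top_covers_notin_one top_covers_in_one by (simp only: ac_simps)

text \<open>The bound \<open>x_set G \<le> x_set F\<close> already forces 1 out of \<open>G\<close>,
  and the family with 1 in \<open>B\<close> is empty.\<close>

theorem min_covers_lex_sets_if_two_notin:
  assumes "2 \<notin> F"
  shows "min_covers n E =
     {gap J k | k. k \<in> J \<and> card (gap J k) \<le> n - q}
     \<union> {gap J k | k. k \<in> J \<and> card (gap J k) = n - q + 1 \<and> x_set (J - {k}) \<le> x_set F}
     \<union> {{1..n} - G | G. G \<subseteq> {1..n} \<and> card G = q - 1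
          \<and> (\<forall>k\<in>J. G \<inter> gap J k \<noteq> {}) \<and> x_set G \<le> x_set F}
     \<union> {C \<in> min_covers n (final_lex_sets n q (insert 1 F)). card C = n - q}"
proof -
  have "1 \<notin> G" if "G \<subseteq> {1..n}" "x_set G \<le> x_set F" for G
  proof
    assume "1 \<in> G"
    moreover have "i \<in> F \<longleftrightarrow> i \<in> G" if "i < 1" for i
    proof -
      have "i \<notin> {1..n}" "i \<notin> {2..n}"
        using that by simp_all
      then show ?thesis using F \<open>G \<subseteq> {1..n}\<close> by blast
    qed
    ultimately have "x_set F < x_set G"
      unfolding x_set_less_iff[OF finF fin[OF that(1)]] using one_notin(1) by blast
    then show False using that by simp
  qed
  then have 1: "{{1..n} - G | G. G \<subseteq> {1..n} \<and> card G = q - 1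
          \<and> (\<forall>k\<in>J. G \<inter> gap J k \<noteq> {}) \<and> x_set G \<le> x_set F} =
      {{1..n} - G | G. G \<subseteq> {1..n} - {1} \<and> card G = q - 1
          \<and> (\<forall>k\<in>J. G \<inter> gap J k \<noteq> {}) \<and> x_set G \<le> x_set F}"
    by blast
  have 2: "{{1..n} - B | B. B \<subseteq> {1..n} \<and> 1 \<in> B \<and> card B = q - 1 \<and> (\<forall>b\<in>{1..n} - B. insert b B \<in> E)} = {}"
    using top_covers_in_one_empty[OF assms] by blast
  show ?thesis
    unfolding min_covers_split top_covers_notin_one 1 2 Un_empty_right by (simp only: ac_simps)
qed

end

section \<open>From minimal covers to the primary decomposition\<close>

theorem theorem2p13:
  fixes n q :: nat and S :: "'k::field mpol ring"
    and F :: "nat set" and j :: "nat \<Rightarrow> nat" and u v :: mon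
    and A :: "nat \<Rightarrow> nat set" and I :: "'k mpol set"
  assumes S: "S = poly_ring n"
    and q: "q \<ge> 2"
    and F: "F \<subseteq> {2..n}" "card F = q - 1"
    and u: "u = xvar 1 + x_set F"
    and j: "\<forall>t\<in>{1..q}. 2 \<le> j t \<and> j t \<le> n" "strict_mono_on {1..q} j"
    and v: "v = (\<Sum>t=1..q. xvar (j t))"
    and completely: "completely_lexseg n (lexseg n q u v)"
    and I: "I = mon_ideal n (lexseg n q u v)"
    and A: "\<forall>t\<in>{1..q}. A t = {1..j t} - j ` {1..<t}"
  shows
    "(2 \<notin> Poly_Mapping.keys u \<longrightarrow>
       minimal_primary_decomposition S I
         ({var_prime n (A t) | t. t \<in> {1..q} \<and> card (A t) \<le> n - q}
          \<union> {var_prime n (A t) | t. t \<in> {1..q} \<and> card (A t) = n - q + 1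
                 \<and> u - xvar 1 \<ge> v - xvar (j t)}
          \<union> {var_prime n ({1..n} - G) | G. G \<subseteq> {1..n} \<and> card G = q - 1
                 \<and> (\<forall>t\<in>{1..q}. G \<inter> A t \<noteq> {}) \<and> u - xvar 1 \<ge> x_set G}
          \<union> {P \<in> minimal_primes S (mon_ideal n (final_lexseg n q u)). height S P = enat (n - q)}))
     \<and>
     (2 \<in> Poly_Mapping.keys u \<longrightarrow>
       minimal_primary_decomposition S I
         ({var_prime n (A t) | t. t \<in> {1..q} \<and> card (A t) \<le> n - q}
          \<union> {var_prime n (A t) | t. t \<in> {1..q} \<and> card (A t) = n - q + 1
                 \<and> u - xvar 1 \<ge> v - xvar (j t)}
          \<union> {var_prime n ({1..n} - G) | G. G \<subseteq> {1..n} - {1} \<and> card G = q - 1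
                 \<and> (\<forall>t\<in>{1..q}. G \<inter> A t \<noteq> {}) \<and> u - xvar 1 \<ge> x_set G}
          \<union> {var_prime n G | G. G \<subseteq> {1..n} - {1} \<and> card G = n - q + 1
                 \<and> x_set (G - {Min G}) \<ge> x_set (({1..n} - F) - {1})}
          \<union> {P \<in> minimal_primes S (mon_ideal n (final_lexseg n q u)). height S P = enat (n - q)}))"
proof -
  define J where "J = j ` {1..q}"
  have inj: "inj_on j {1..q}"
    using j(2) by (rule strict_mono_on_imp_inj_on)
  have vJ: "v = x_set J"
    unfolding v J_def x_set_def sum.reindex[OF inj] by simp
  have finF: "finite F"
    using F(1) finite_subset by blast
  have "1 \<notin> F"
    using F(1) by auto
  then have uF: "u = x_set (insert 1 F)"
    using u finF by (simp add: x_set_insert)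
  interpret squarefree_lexsegment n q F J
    using q F j completely card_image[OF inj] unfolding uF vJ
    by unfold_locales (auto simp: J_def)
  \<comment> \<open>As \<open>j\<close> is increasing, the elements of \<open>J\<close> below
    \<open>j t\<close> are those with smaller index.\<close>
  have At: "A t = gap J (j t)" if t: "t \<in> {1..q}" for t
  proof -
    have "{i \<in> J. i < j t} = j ` {1..<t}"
    proof (intro equalityI subsetI)
      fix i assume "i \<in> {i \<in> J. i < j t}"
      then obtain s where s: "s \<in> {1..q}" "i = j s" "j s < j t"
        by (auto simp: J_def)
      then have "s < t"
        using strict_mono_on_less[OF j(2) s(1) t] by blast
      then show "i \<in> j ` {1..<t}"
        using s by auto
    next
      fix i assume "i \<in> j ` {1..<t}"
      then obtain s where s: "s \<in> {1..<t}" "i = j s"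
        by blast
      then have "s \<in> {1..q}"
        using t by simp
      then show "i \<in> {i \<in> J. i < j t}"
        using s strict_mono_on_less[OF j(2) _ t] by (auto simp: J_def)
    qed
    then show ?thesis
      using A t by (simp add: gap_def)
  qed
  have meets: "(\<forall>t\<in>{1..q}. G \<inter> A t \<noteq> {}) \<longleftrightarrow> (\<forall>k\<in>J. G \<inter> gap J k \<noteq> {})" for G
    using At by (auto simp: J_def)
  \<comment> \<open>Generic change from indices \<open>t\<close> to elements \<open>k = j t\<close>,
    applied to the first two families.\<close>
  have gaps: "{var_prime n (A t) | t. t \<in> {1..q} \<and> Q t} =
      (var_prime n ` {gap J k | k. k \<in> J \<and> R k} :: 'k mpol set set)"
    if QR: "\<And>t. t \<in> {1..q} \<Longrightarrow> Q t \<longleftrightarrow> R (j t)" for Q R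
  proof (intro equalityI subsetI)
    fix P :: "'k mpol set" assume "P \<in> {var_prime n (A t) | t. t \<in> {1..q} \<and> Q t}"
    then obtain t where t: "P = var_prime n (A t)" "t \<in> {1..q}" "Q t"
      by blast
    then have "j t \<in> J" "R (j t)" "P = var_prime n (gap J (j t))"
      using QR At by (auto simp: J_def)
    then show "P \<in> var_prime n ` {gap J k | k. k \<in> J \<and> R k}"
      by blast
  next
    fix P :: "'k mpol set" assume "P \<in> var_prime n ` {gap J k | k. k \<in> J \<and> R k}"
    then obtain t where "P = var_prime n (gap J (j t))" "t \<in> {1..q}" "R (j t)"
      unfolding J_def by blast
    then have "P = var_prime n (A t)" "t \<in> {1..q}" "Q t"
      using QR At by simp_all
    then show "P \<in> {var_prime n (A t) | t. t \<in> {1..q} \<and> Q t}"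
      by blast
  qed
  have small: "{var_prime n (A t) | t. t \<in> {1..q} \<and> card (A t) \<le> n - q} =
      (var_prime n ` {gap J k | k. k \<in> J \<and> card (gap J k) \<le> n - q} :: 'k mpol set set)"
    by (rule gaps) (simp add: At)
  have u1: "u - xvar 1 = x_set F"
    by (simp add: u)
  have vt: "v - xvar (j t) = x_set (J - {j t})" if "t \<in> {1..q}" for t
    using that unfolding vJ by (intro x_set_diff_xvar) (auto simp: J_def)
  have large: "{var_prime n (A t) | t. t \<in> {1..q} \<and> card (A t) = n - q + 1 \<and> x_set F \<ge> v - xvar (j t)} =
      (var_prime n ` {gap J k | k. k \<in> J \<and> card (gap J k) = n - q + 1 \<and> x_set (J - {k}) \<le> x_set F}
        :: 'k mpol set set)"
    by (rule gaps) (simp only: At vt)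
  \<comment> \<open>The minimal primes of \<open>(L^f(u))\<close> are generated by variables, so the
    height condition becomes one on cardinality.\<close>
  have final: "{P \<in> minimal_primes S (mon_ideal n (final_lexseg n q u)). height S P = enat (n - q)} =
      (var_prime n ` {C \<in> min_covers n (final_lex_sets n q (insert 1 F)). card C = n - q} :: 'k mpol set set)"
  proof -
    have sub: "final_lex_sets n q (insert 1 F) \<subseteq> Pow {1..n}"
      by (auto simp: final_lex_sets_def)
    have "height S (var_prime n C :: 'k mpol set) = enat (card C)"
      if "C \<in> min_covers n (final_lex_sets n q (insert 1 F))" for C
      unfolding S using that by (intro height_var_prime) (simp add: min_covers_def covers_def)
    then show ?thesis
      unfolding uF final_lexseg_eq_image S minimal_primes_edge_ideal[OF sub] by (auto simp flip: S)
  qed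
  have E: "E \<subseteq> Pow {1..n}"
    by (auto simp: lex_sets_def)
  have decomposition: "minimal_primary_decomposition S I (var_prime n ` min_covers n E)"
    using minimal_primary_decomposition_edge_ideal[OF E] unfolding S I uF vJ lexseg_eq_image .
  have two: "2 \<in> Poly_Mapping.keys u \<longleftrightarrow> 2 \<in> F"
    unfolding uF using finF by simp
  have covers_image: "{var_prime n ({1..n} - G) | G. Q G} = (var_prime n ` {{1..n} - G | G. Q G} :: 'k mpol set set)"
      "{var_prime n G | G. Q G} = (var_prime n ` {G. Q G} :: 'k mpol set set)" for Q
    by blast+
  show ?thesis
    unfolding u1 small large final meets two covers_image image_Un[symmetric]
  proof (intro conjI impI)
    assume "2 \<notin> F"
    from decomposition[unfolded min_covers_lex_sets_if_two_notin[OF this]]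
    show "minimal_primary_decomposition S I (var_prime n `
        ({gap J k | k. k \<in> J \<and> card (gap J k) \<le> n - q}
         \<union> {gap J k | k. k \<in> J \<and> card (gap J k) = n - q + 1 \<and> x_set (J - {k}) \<le> x_set F}
         \<union> {{1..n} - G | G. G \<subseteq> {1..n} \<and> card G = q - 1
              \<and> (\<forall>k\<in>J. G \<inter> gap J k \<noteq> {}) \<and> x_set G \<le> x_set F}
         \<union> {C \<in> min_covers n (final_lex_sets n q (insert 1 F)). card C = n - q}))" .
  next
    from decomposition[unfolded min_covers_lex_sets]
    show "minimal_primary_decomposition S I (var_prime n `
        ({gap J k | k. k \<in> J \<and> card (gap J k) \<le> n - q}
         \<union> {gap J k | k. k \<in> J \<and> card (gap J k) = n - q + 1 \<and> x_set (J - {k}) \<le> x_set F}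
         \<union> {{1..n} - G | G. G \<subseteq> {1..n} - {1} \<and> card G = q - 1
              \<and> (\<forall>k\<in>J. G \<inter> gap J k \<noteq> {}) \<and> x_set G \<le> x_set F}
         \<union> {G. G \<subseteq> {1..n} - {1} \<and> card G = n - q + 1
              \<and> x_set (({1..n} - F) - {1}) \<le> x_set (G - {Min G})}
         \<union> {C \<in> min_covers n (final_lex_sets n q (insert 1 F)). card C = n - q}))" .
  qed
qed

end
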